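(* Let $k\geq 1$ and $n\geq k+1$ be integers and let $G$ be a $k$-tree on $n$ vertices with $G\not\cong S_{k,n-k}$ and $G\not\cong G_1$. Then $q_1(G)\leq q_1(G_2)$, with equality if and only if $G\cong G_2$.
   Context: A $k$-tree is either the complete graph $K_k$ or a graph obtained from a smaller $k$-tree by adding a new vertex joined by $k$ edges to the vertices of a $k$-clique. $q_1(G)$ is the largest eigenvalue of the signless Laplacian $Q(G)=D(G)+A(G)$ (degree diagonal matrix plus adjacency matrix). The $k$-star $S_{k,n-k}$ has vertex set $\{v_1,\dots,v_k,u_1,\dots,u_{n-k}\}$, where $v_1,\dots,v_k$ form a clique, each $u_i$ is adjacent to all $v_j$, and the $u_i$ are pairwise nonadjacent. $G_1$ is obtained from $S_{k,n-k}$ by deleting the edge $u_1v_k$ and adding the edge $u_1u_2$, and for $n\geq k+3$, $G_2$ is obtained from $G_1$ by deleting the edge $u_3v_k$ and adding the edge $u_3u_2$. *)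

theory Defs
  imports
    "Graph_Theory.Graph_Theory"
    "Jordan_Normal_Form.Spectral_Radius"
begin

text \<open>
  A simple undirected graph is represented as in the AFP entry Graph Theory: a pair digraph
  that is finite, loop-free and symmetric (locale \<open>pair_graph\<close>), so that an undirected edge
  is a pair of opposite arcs. Graph isomorphism is \<open>digraph_iso\<close>.
\<close>

definition add_edge :: "'a \<Rightarrow> 'a \<Rightarrow> 'a pair_pre_digraph \<Rightarrow> 'a pair_pre_digraph" where
  "add_edge u v G = \<lparr>pverts = pverts G, parcs = parcs G \<union> {(u, v), (v, u)}\<rparr>"

definition delete_edge :: "'a \<Rightarrow> 'a \<Rightarrow> 'a pair_pre_digraph \<Rightarrow> 'a pair_pre_digraph" where
  "delete_edge u v G = \<lparr>pverts = pverts G, parcs = parcs G - {(u, v), (v, u)}\<rparr>"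

definition join_vertex :: "'a \<Rightarrow> 'a set \<Rightarrow> 'a pair_pre_digraph \<Rightarrow> 'a pair_pre_digraph" where
  "join_vertex v C G = \<lparr>pverts = insert v (pverts G), parcs = parcs G \<union> {v} \<times> C \<union> C \<times> {v}\<rparr>"

definition clique :: "'a pair_pre_digraph \<Rightarrow> 'a set \<Rightarrow> bool" where
  "clique G C \<longleftrightarrow> C \<subseteq> pverts G \<and> (\<forall>u\<in>C. \<forall>w\<in>C. u \<noteq> w \<longrightarrow> (u, w) \<in> parcs G)"

inductive k_tree :: "nat \<Rightarrow> 'a pair_pre_digraph \<Rightarrow> bool" for k :: nat where
  complete: "K\<^bsub>k\<^esub> (with_proj G) \<Longrightarrow> k_tree k G"
| join: "\<lbrakk>k_tree k G; clique G C; card C = k; v \<notin> pverts G\<rbrakk> \<Longrightarrow> k_tree k (join_vertex v C G)"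

text \<open>
  The matrices are indexed by positions in a list \<open>vs\<close> enumerating the vertices without
  repetition.
\<close>

definition degree_mat :: "'a pair_pre_digraph \<Rightarrow> 'a list \<Rightarrow> real mat" where
  "degree_mat G vs = mat (length vs) (length vs)
     (\<lambda>(i, j). if i = j then real (out_degree (with_proj G) (vs ! i)) else 0)"

definition adjacency_mat :: "'a pair_pre_digraph \<Rightarrow> 'a list \<Rightarrow> real mat" where
  "adjacency_mat G vs = mat (length vs) (length vs)
     (\<lambda>(i, j). if (vs ! i, vs ! j) \<in> parcs G then 1 else 0)"

definition signless_laplacian :: "'a pair_pre_digraph \<Rightarrow> 'a list \<Rightarrow> real mat" where
  "signless_laplacian G vs = degree_mat G vs + adjacency_mat G vs"

definition enumerates :: "'a list \<Rightarrow> 'a pair_pre_digraph \<Rightarrow> bool" where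
  "enumerates vs G \<longleftrightarrow> distinct vs \<and> set vs = pverts G"

text \<open>The choice of the enumeration is immaterial, see \<open>q1_eq\<close> below.\<close>

definition q1 :: "'a pair_pre_digraph \<Rightarrow> real" where
  "q1 G = Max (spectrum (signless_laplacian G (SOME vs. enumerates vs G)))"

lemma spectrum_signless_laplacian_subset:
  assumes vs: "enumerates vs G" and ws: "enumerates ws G"
  shows "spectrum (signless_laplacian G vs) \<subseteq> spectrum (signless_laplacian G ws)"
proof
  fix a assume "a \<in> spectrum (signless_laplacian G vs)"
  then obtain x where x: "eigenvector (signless_laplacian G vs) x a"
    by (auto simp: spectrum_def eigenvalue_def)
  define n where "n = length vs"
  have len: "length ws = n"
    using vs ws unfolding enumerates_def n_def by (metis distinct_card)
  have bv: "bij_betw (\<lambda>i. vs ! i) {..<n} (pverts G)"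
    using vs unfolding enumerates_def n_def by (auto intro!: bij_betw_nth)
  have bw: "bij_betw (\<lambda>i. ws ! i) {..<n} (pverts G)"
    using ws len unfolding enumerates_def by (auto intro!: bij_betw_nth)
  define f where "f = (\<lambda>i. inv_into {..<n} (\<lambda>i. vs ! i) (ws ! i))"
  have bf: "bij_betw f {..<n} {..<n}"
    using bij_betw_trans[OF bw bij_betw_inv_into[OF bv]] by (simp add: f_def comp_def)
  have fn: "f i < n" if "i < n" for i
    using bf that by (auto simp: bij_betw_def)
  have vf: "vs ! f i = ws ! i" if "i < n" for i
    using that bw bv unfolding f_def
    by (intro f_inv_into_f[of _ "\<lambda>i. vs ! i"]) (auto simp: bij_betw_def)
  have f_eq: "f i = f j \<longleftrightarrow> i = j" if "i < n" "j < n" for i j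
    using bf that by (auto simp: bij_betw_def inj_on_def)
  let ?A = "signless_laplacian G vs" and ?B = "signless_laplacian G ws"
  have entry: "?B $$ (i, j) = ?A $$ (f i, f j)" if "i < n" "j < n" for i j
    using that fn vf f_eq len
    by (simp add: signless_laplacian_def degree_mat_def adjacency_mat_def n_def)
  have dims: "?A \<in> carrier_mat n n" "?B \<in> carrier_mat n n"
    using len by (auto simp: signless_laplacian_def degree_mat_def adjacency_mat_def n_def)
  have xc: "x \<in> carrier_vec n" and x0: "x \<noteq> 0\<^sub>v n" and xe: "?A *\<^sub>v x = a \<cdot>\<^sub>v x"
    using x dims by (auto simp: eigenvector_def)
  define y where "y = vec n (\<lambda>i. x $ f i)"
  have "y \<noteq> 0\<^sub>v n"
  proof
    assume y0: "y = 0\<^sub>v n"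
    have "x $ i = 0" if "i < n" for i
    proof -
      have "i \<in> f ` {..<n}"
        using bf that by (simp add: bij_betw_def)
      then obtain j where j: "j < n" "i = f j"
        by auto
      then have "y $ j = x $ i" by (simp add: y_def)
      then show ?thesis using y0 j by simp
    qed
    then show False using x0 xc by auto
  qed
  moreover have "?B *\<^sub>v y = a \<cdot>\<^sub>v y"
  proof (rule eq_vecI)
    fix i assume "i < dim_vec (a \<cdot>\<^sub>v y)"
    then have i: "i < n" by (simp add: y_def)
    have "(?B *\<^sub>v y) $ i = (\<Sum>j<n. ?B $$ (i, j) * y $ j)"
      using i dims by (simp add: scalar_prod_def y_def lessThan_atLeast0)
    also have "\<dots> = (\<Sum>j<n. ?A $$ (f i, f j) * x $ f j)"
      using i entry by (intro sum.cong) (auto simp: y_def)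
    also have "\<dots> = (\<Sum>j<n. ?A $$ (f i, j) * x $ j)"
      using sum.reindex_bij_betw[OF bf, of "\<lambda>j. ?A $$ (f i, j) * x $ j"] by simp
    also have "\<dots> = (?A *\<^sub>v x) $ f i"
      using fn[OF i] dims xc by (simp add: scalar_prod_def lessThan_atLeast0)
    also have "\<dots> = (a \<cdot>\<^sub>v y) $ i"
      using i fn[OF i] xe xc by (simp add: y_def)
    finally show "(?B *\<^sub>v y) $ i = (a \<cdot>\<^sub>v y) $ i" .
  qed (use dims in \<open>auto simp: y_def\<close>)
  ultimately have "eigenvector ?B y a"
    using dims by (auto simp: eigenvector_def y_def)
  then show "a \<in> spectrum ?B"
    by (auto simp: spectrum_def eigenvalue_def)
qed

lemma q1_eq:
  assumes "enumerates vs G"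
  shows "q1 G = Max (spectrum (signless_laplacian G vs))"
proof -
  have "enumerates (SOME vs. enumerates vs G) G"
    using assms by (rule someI)
  then show ?thesis
    unfolding q1_def using assms spectrum_signless_laplacian_subset by (metis subset_antisym)
qed

datatype star_vertex = V nat | U nat

definition k_star :: "nat \<Rightarrow> nat \<Rightarrow> star_vertex pair_pre_digraph" where
  "k_star k m = \<lparr>
     pverts = V ` {1..k} \<union> U ` {1..m},
     parcs = {(V i, V j) | i j. i \<in> {1..k} \<and> j \<in> {1..k} \<and> i \<noteq> j}
       \<union> {(U i, V j) | i j. i \<in> {1..m} \<and> j \<in> {1..k}}
       \<union> {(V j, U i) | i j. i \<in> {1..m} \<and> j \<in> {1..k}}\<rparr>"

text \<open>
  The graphs \<open>G\<^sub>1\<close> and \<open>G\<^sub>2\<close> on \<open>n\<close> vertices are meaningful for \<open>n \<ge> k + 2\<close> and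
  \<open>n \<ge> k + 3\<close> respectively, since the vertices \<open>u\<^sub>2\<close> and \<open>u\<^sub>3\<close> have to exist.
\<close>

definition graph_G1 :: "nat \<Rightarrow> nat \<Rightarrow> star_vertex pair_pre_digraph" where
  "graph_G1 k n = add_edge (U 1) (U 2) (delete_edge (U 1) (V k) (k_star k (n - k)))"

definition graph_G2 :: "nat \<Rightarrow> nat \<Rightarrow> star_vertex pair_pre_digraph" where
  "graph_G2 k n = add_edge (U 3) (U 2) (delete_edge (U 3) (V k) (graph_G1 k n))"

end

theory Submission
  imports Defs "HOL-Analysis.Function_Topology" "HOL-Combinatorics.Transposition"
begin

text \<open>
  Shifting \<open>u\<close> to \<open>v\<close> (the Kelmans operation) makes \<open>v\<close> adjacent to everything adjacent to \<open>u\<close>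
  or \<open>v\<close> and leaves \<open>u\<close> adjacent only to what is adjacent to both. Evaluating the quadratic
  form of \<open>Q\<close> at the Perron vector shows that one of the two shifts along a pair of vertices with
  incomparable neighbourhoods strictly increases \<open>q\<^sub>1\<close>; the two results are isomorphic, so both do.
  Along an edge, a shift maps \<open>k\<close>-trees to \<open>k\<close>-trees, and a \<open>k\<close>-tree in which adjacent vertices
  always have comparable neighbourhoods is a \<open>k\<close>-star. Hence every other \<open>k\<close>-tree can be improved
  until it becomes \<open>S\<^bsub>k,n-k\<^esub>\<close> or \<open>G\<^sub>1\<close>, and it remains to look at the \<open>k\<close>-trees one step before.
  A shift producing the \<open>k\<close>-star starts from the join of \<open>K\<^bsub>k-1\<^esub>\<close> with a double star, where
  moving leaves from one centre to the other leads to \<open>G\<^sub>2\<close>. Since \<open>k\<close>-trees have no induced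
  4-cycle, only three families are mapped to \<open>G\<^sub>1\<close>, and other shifts lead from each of these to
  a double star whose two centres carry at least two leaves each, or to \<open>G\<^sub>1 \<cong> G\<^sub>2\<close> if \<open>n = k + 4\<close>.
\<close>

section \<open>The largest signless Laplacian eigenvalue as a Rayleigh quotient\<close>

lemma pair_graph_iff:
  "pair_graph G \<longleftrightarrow> finite (pverts G) \<and> parcs G \<subseteq> pverts G \<times> pverts G \<and>
     (\<forall>u v. (u, v) \<in> parcs G \<longrightarrow> u \<noteq> v \<and> (v, u) \<in> parcs G)" (is "?L \<longleftrightarrow> ?R")
proof
  assume ?L
  then interpret pair_graph G .
  show ?R
    using pair_finite_verts in_arcsD1 in_arcsD2 pair_no_loops sym_arcs
    by (fastforce simp: symmetric_def dest: symD)
next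
  assume R: ?R
  then have "finite (parcs G)"
    by (meson finite_SigmaI finite_subset)
  then show ?L
    using R by unfold_locales (auto simp: symmetric_def sym_def)
qed

text \<open>The signless Laplacian acting on functions of the vertices, so that no enumeration
  enters. Repeating \<open>x v\<close> once per neighbour produces the degree term.\<close>

definition Q_op :: "'a pair_pre_digraph \<Rightarrow> ('a \<Rightarrow> real) \<Rightarrow> 'a \<Rightarrow> real" where
  "Q_op G x v = (\<Sum>w | (v, w) \<in> parcs G. x v + x w)"

lemma finite_nbhd: "pair_graph G \<Longrightarrow> finite {w. (v, w) \<in> parcs G}"
  by (rule finite_subset[of _ "pverts G"]) (auto simp: pair_graph_iff)

lemma out_degree_eq: "out_degree (with_proj G) v = card {w. (v, w) \<in> parcs G}"
proof -
  have "out_arcs (with_proj G) v = Pair v ` {w. (v, w) \<in> parcs G}"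
    by (auto simp: out_arcs_def)
  then show ?thesis
    by (simp add: out_degree_def card_image inj_on_def)
qed

lemma signless_laplacian_mult:
  assumes "pair_graph G" "enumerates vs G" "i < length vs"
  shows "(signless_laplacian G vs *\<^sub>v vec (length vs) (\<lambda>i. x (vs ! i))) $ i = Q_op G x (vs ! i)"
proof -
  define n where "n = length vs"
  let ?v = "vs ! i"
  have bv: "bij_betw (\<lambda>i. vs ! i) {0..<n} (pverts G)"
    using assms(2) unfolding enumerates_def n_def atLeast0LessThan by (auto intro!: bij_betw_nth)
  have inP: "?v \<in> pverts G" using assms by (metis enumerates_def nth_mem)
  have fin: "finite (pverts G)" using assms by (simp add: pair_graph_iff)
  have nth_eq: "?v = vs ! j \<longleftrightarrow> i = j" if "j < n" for j
    using that assms nth_eq_iff_index_eq[of vs i j] by (simp add: enumerates_def n_def)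
  have "(signless_laplacian G vs *\<^sub>v vec n (\<lambda>i. x (vs ! i))) $ i
    = (\<Sum>j = 0..<n. signless_laplacian G vs $$ (i, j) * x (vs ! j))"
    using assms by (auto simp: scalar_prod_def signless_laplacian_def degree_mat_def adjacency_mat_def n_def)
  also have "\<dots> = (\<Sum>j = 0..<n. (if ?v = vs ! j then real (card {w. (?v, w) \<in> parcs G}) * x (vs ! j) else 0)
     + (if (?v, vs ! j) \<in> parcs G then x (vs ! j) else 0))"
    using assms nth_eq
    by (intro sum.cong)
      (auto simp: signless_laplacian_def degree_mat_def adjacency_mat_def n_def out_degree_eq algebra_simps)
  also have "\<dots> = (\<Sum>w\<in>pverts G. (if ?v = w then real (card {w. (?v, w) \<in> parcs G}) * x w else 0)
     + (if (?v, w) \<in> parcs G then x w else 0))"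
    by (rule sum.reindex_bij_betw[OF bv])
  also have "\<dots> = real (card {w. (?v, w) \<in> parcs G}) * x ?v + (\<Sum>w | (?v, w) \<in> parcs G. x w)"
  proof -
    have "(\<Sum>w\<in>pverts G. if (?v, w) \<in> parcs G then x w else 0) = (\<Sum>w | (?v, w) \<in> parcs G. x w)"
      using assms(1) by (intro sum.mono_neutral_cong_right fin) (auto simp: pair_graph_iff)
    then show ?thesis using inP fin by (simp add: sum.distrib)
  qed
  also have "\<dots> = Q_op G x ?v"
    by (simp add: Q_op_def sum.distrib)
  finally show ?thesis by (simp add: n_def)
qed

text \<open>Vectors indexed by positions in \<open>vs\<close> correspond to functions on the
  vertices. Values off the vertex set never enter, so nonvanishing is asked for on
  \<open>pverts G\<close> only.\<close>

lemma spectrum_signless_laplacian: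
  assumes G: "pair_graph G" and vs: "enumerates vs G"
  shows "spectrum (signless_laplacian G vs) =
    {a. \<exists>x. (\<exists>v\<in>pverts G. x v \<noteq> 0) \<and> (\<forall>v\<in>pverts G. Q_op G x v = a * x v)}" (is "_ = ?R")
proof -
  let ?n = "length vs" and ?A = "signless_laplacian G vs"
  have dim: "?A \<in> carrier_mat ?n ?n"
    by (auto simp: signless_laplacian_def degree_mat_def adjacency_mat_def)
  have P: "pverts G = (\<lambda>i. vs ! i) ` {..<?n}"
    using vs unfolding enumerates_def set_conv_nth by blast
  have inj: "inj_on (\<lambda>i. vs ! i) {..<?n}"
    using vs unfolding enumerates_def by (intro inj_on_nth) auto
  have eq: "eigenvector ?A (vec ?n (\<lambda>i. x (vs ! i))) a \<longleftrightarrow>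
      (\<exists>v\<in>pverts G. x v \<noteq> 0) \<and> (\<forall>v\<in>pverts G. Q_op G x v = a * x v)" for x a
  proof -
    have "vec ?n (\<lambda>i. x (vs ! i)) \<noteq> 0\<^sub>v ?n \<longleftrightarrow> (\<exists>v\<in>pverts G. x v \<noteq> 0)"
      by (auto simp: P vec_eq_iff)
    moreover have "?A *\<^sub>v vec ?n (\<lambda>i. x (vs ! i)) = a \<cdot>\<^sub>v vec ?n (\<lambda>i. x (vs ! i)) \<longleftrightarrow>
        (\<forall>v\<in>pverts G. Q_op G x v = a * x v)"
    proof -
      have "dim_vec (?A *\<^sub>v z) = ?n" for z using dim by simp
      then show ?thesis
        unfolding vec_eq_iff P by (auto simp: signless_laplacian_mult[OF G vs] simp del: index_mult_mat_vec)
    qed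
    ultimately show ?thesis using dim by (auto simp: eigenvector_def)
  qed
  show ?thesis
  proof (intro equalityI subsetI)
    fix a assume "a \<in> spectrum ?A"
    then obtain y where y: "eigenvector ?A y a"
      by (auto simp: spectrum_def eigenvalue_def)
    define x where "x v = y $ the_inv_into {..<?n} (\<lambda>i. vs ! i) v" for v
    have "y = vec ?n (\<lambda>i. x (vs ! i))"
      using y dim the_inv_into_f_f[OF inj] by (intro eq_vecI) (simp_all add: x_def eigenvector_def)
    then show "a \<in> ?R" using y eq[of x a] by blast
  next
    fix a assume "a \<in> ?R"
    then show "a \<in> spectrum ?A" unfolding spectrum_def eigenvalue_def using eq by blast
  qed
qed

section \<open>The quadratic form and its maximum on the unit sphere\<close>

text \<open>Every edge occurs as two opposite arcs, so this is twice the bilinear form of the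
  signless Laplacian; hence the factor 2 in the estimates below.\<close>

definition Q_form :: "'a pair_pre_digraph \<Rightarrow> ('a \<Rightarrow> real) \<Rightarrow> ('a \<Rightarrow> real) \<Rightarrow> real" where
  "Q_form G x y = (\<Sum>(v, w)\<in>parcs G. (x v + x w) * (y v + y w))"

lemma Q_form_eq:
  assumes "pair_graph G"
  shows "Q_form G x y = 2 * (\<Sum>v\<in>pverts G. Q_op G x v * y v)"
proof -
  have fin: "finite (pverts G)" and E: "parcs G = (SIGMA v:pverts G. {w. (v, w) \<in> parcs G})"
    using assms by (auto simp: pair_graph_iff)
  have "(\<Sum>v\<in>pverts G. Q_op G x v * y v)
      = (\<Sum>v\<in>pverts G. \<Sum>w | (v, w) \<in> parcs G. (x v + x w) * y v)"
    unfolding Q_op_def by (intro sum.cong refl sum_distrib_right)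
  also have "\<dots> = (\<Sum>(v, w)\<in>(SIGMA v:pverts G. {w. (v, w) \<in> parcs G}). (x v + x w) * y v)"
    using finite_nbhd[OF assms] fin by (simp add: sum.Sigma)
  finally have 1: "(\<Sum>v\<in>pverts G. Q_op G x v * y v) = (\<Sum>(v, w)\<in>parcs G. (x v + x w) * y v)"
    using E by simp
  \<comment> \<open>Reversing all arcs replaces the weight \<open>y v\<close> by \<open>y w\<close>;
    adding both versions gives the symmetric summand.\<close>
  have "(\<Sum>(v, w)\<in>parcs G. (x v + x w) * y v) = (\<Sum>(v, w)\<in>parcs G. (x v + x w) * y w)"
    using assms
    by (intro sum.reindex_bij_witness[of _ prod.swap prod.swap]) (auto simp: pair_graph_iff)
  then have "2 * (\<Sum>(v, w)\<in>parcs G. (x v + x w) * y v) =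
      (\<Sum>(v, w)\<in>parcs G. (x v + x w) * y v) + (\<Sum>(v, w)\<in>parcs G. (x v + x w) * y w)"
    by simp
  also have "\<dots> = Q_form G x y"
    unfolding Q_form_def sum.distrib[symmetric] by (intro sum.cong) (auto simp: algebra_simps)
  finally show ?thesis using 1 by simp
qed

text \<open>A continuous form attains its maximum on the compact unit sphere, and homogeneity
  extends the bound to all functions.\<close>

lemma Q_form_maximizer_exists:
  assumes G: "pair_graph G" and ne: "pverts G \<noteq> {}"
  obtains x l where "\<exists>v\<in>pverts G. x v \<noteq> 0"
    "Q_form G x x = 2 * l * (\<Sum>v\<in>pverts G. (x v)\<^sup>2)"
    "\<And>y. Q_form G y y \<le> 2 * l * (\<Sum>v\<in>pverts G. (y v)\<^sup>2)"
proof -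
  define P where "P = pverts G"
  define S where "S y = (\<Sum>v\<in>P. (y v)\<^sup>2)" for y :: "'a \<Rightarrow> real"
  have fin: "finite P" and E: "parcs G \<subseteq> P \<times> P"
    using G by (auto simp: pair_graph_iff P_def)
  \<comment> \<open>Pinning the coordinates outside \<open>P\<close> to 0 makes the sphere a closed
    subset of a product of compact sets, to which Tychonoff's theorem applies.\<close>
  define B where "B v = (if v \<in> P then {-1..1} else {0::real})" for v
  define K where "K = Pi\<^sub>E UNIV B \<inter> {y. S y = 1}"
  have coord: "continuous_on UNIV (\<lambda>y :: 'a \<Rightarrow> real. y v)" for v
    by simp
  have contS: "continuous_on UNIV S"
    unfolding S_def by (intro continuous_intros coord)
  have contQ: "continuous_on UNIV (\<lambda>y. Q_form G y y)"
    unfolding Q_form_def case_prod_beta by (intro continuous_intros coord)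
  have "compact (Pi\<^sub>E UNIV B)"
  proof -
    have "compactin (product_topology (\<lambda>v. euclidean) UNIV) (Pi\<^sub>E UNIV B)"
      by (auto simp: compactin_PiE B_def)
    then show ?thesis by (simp add: euclidean_product_topology)
  qed
  moreover have "closed {y. S y = 1}"
    using contS by (intro closed_Collect_eq) auto
  ultimately have "compact K"
    unfolding K_def by (rule compact_Int_closed)
  moreover obtain p where "p \<in> P" using ne by (auto simp: P_def)
  then have "(\<lambda>v. if v = p then 1 else 0) \<in> K"
    using fin by (auto simp: K_def S_def B_def if_distrib[of "\<lambda>x. x\<^sup>2"] cong: if_cong)
  then have "K \<noteq> {}" by auto
  ultimately obtain x where x: "x \<in> K" "\<And>y. y \<in> K \<Longrightarrow> Q_form G y y \<le> Q_form G x x"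
    using continuous_attains_sup[of K "\<lambda>y. Q_form G y y"] contQ continuous_on_subset by blast
  have Sx: "S x = 1" using x by (simp add: K_def)
  show ?thesis
  proof (rule that[of x "Q_form G x x / 2"])
    show "\<exists>v\<in>pverts G. x v \<noteq> 0"
    proof (rule ccontr)
      assume "\<not> ?thesis"
      then have "S x = 0" by (simp add: S_def P_def)
      then show False using Sx by simp
    qed
    show "Q_form G x x = 2 * (Q_form G x x / 2) * (\<Sum>v\<in>pverts G. (x v)\<^sup>2)"
      using Sx by (simp add: S_def P_def)
    fix y :: "'a \<Rightarrow> real"
    have "Q_form G y y \<le> Q_form G x x * S y"
    proof (cases "S y = 0")
      case True
      then have "\<forall>v\<in>P. y v = 0" using fin by (simp add: S_def sum_nonneg_eq_0_iff)
      then have "Q_form G y y = 0"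
        unfolding Q_form_def using E by (intro sum.neutral) auto
      then show ?thesis using True by simp
    next
      case False
      then have Sy: "S y > 0"
        by (metis S_def less_eq_real_def sum_nonneg zero_le_power2)
      \<comment> \<open>Scaling to the unit sphere; both the form and the squared norm are
        multiplied by the square of \<open>c\<close>.\<close>
      define c where "c = 1 / sqrt (S y)"
      have c2: "c\<^sup>2 = 1 / S y" using Sy by (simp add: c_def power_divide)
      define z where "z v = (if v \<in> P then c * y v else 0)" for v
      have "S z = c\<^sup>2 * S y"
        unfolding S_def z_def by (simp add: power_mult_distrib sum_distrib_left)
      then have Sz: "S z = 1" using c2 Sy by simp
      have "\<bar>z v\<bar> \<le> 1" if "v \<in> P" for v
      proof -
        have "(z v)\<^sup>2 \<le> S z" unfolding S_def using that fin by (intro member_le_sum) auto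
        then show ?thesis using Sz by (simp add: abs_square_le_1)
      qed
      then have "z \<in> K" using Sz by (force simp: K_def B_def z_def abs_le_iff)
      then have "Q_form G z z \<le> Q_form G x x" using x by auto
      moreover have "Q_form G z z = c\<^sup>2 * Q_form G y y"
        unfolding Q_form_def sum_distrib_left
        using E by (intro sum.cong) (auto simp: z_def power2_eq_square algebra_simps)
      ultimately show ?thesis using Sy c2 by (simp add: field_simps)
    qed
    then show "Q_form G y y \<le> 2 * (Q_form G x x / 2) * (\<Sum>v\<in>pverts G. (y v)\<^sup>2)"
      by (simp add: S_def P_def)
  qed
qed

text \<open>Near 0 a nonzero linear term outweighs the quadratic one and changes sign.\<close>

lemma linear_coeff_zero:
  fixes b c :: real
  assumes "\<And>t. t * b + t\<^sup>2 * c \<ge> 0"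
  shows "b = 0"
proof (rule ccontr)
  assume "b \<noteq> 0"
  \<comment> \<open>A positive number exceeding \<open>c\<close>, so that at
    \<open>t = - b / d\<close> the negative linear term wins.\<close>
  define d where "d = \<bar>c\<bar> + 1"
  have d: "d > 0" "c < d" by (auto simp: d_def)
  have "(- b / d) * b + (- b / d)\<^sup>2 * c = b\<^sup>2 / d * (c / d - 1)"
    using d by (simp add: power2_eq_square field_simps)
  also have "\<dots> < 0"
    using d \<open>b \<noteq> 0\<close> by (intro mult_pos_neg) auto
  finally show False using assms[of "- b / d"] by simp
qed

lemma Q_form_add_scaled:
  "Q_form G (\<lambda>v. x v + t * y v) (\<lambda>v. x v + t * y v)
    = Q_form G x x + 2 * t * Q_form G x y + t\<^sup>2 * Q_form G y y"
proof -
  have "(a + t * b + (c + t * d)) * (a + t * b + (c + t * d))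
      = (a + c) * (a + c) + 2 * t * ((a + c) * (b + d)) + t\<^sup>2 * ((b + d) * (b + d))" for a b c d :: real
  proof -
    have "a + t * b + (c + t * d) = (a + c) + t * (b + d)"
      by (simp add: distrib_left)
    moreover have "(r + t * s) * (r + t * s) = r * r + 2 * t * (r * s) + t\<^sup>2 * (s * s)" for r s :: real
      by (simp add: power2_eq_square distrib_left distrib_right)
    ultimately show ?thesis by presburger
  qed
  then show ?thesis
    unfolding Q_form_def sum_distrib_left case_prod_beta sum.distrib[symmetric] by (intro sum.cong refl)
qed

text \<open>First variation: perturbing the maximizer at the single vertex \<open>v\<close> leaves a
  nonnegative quadratic polynomial in the step size, whose linear coefficient is proportional to the
  defect in the eigenvalue equation at \<open>v\<close>.\<close>

lemma Q_form_maximizer_eigen: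
  assumes G: "pair_graph G"
    and eq: "Q_form G x x = 2 * l * (\<Sum>v\<in>pverts G. (x v)\<^sup>2)"
    and le: "\<And>y. Q_form G y y \<le> 2 * l * (\<Sum>v\<in>pverts G. (y v)\<^sup>2)"
    and v: "v \<in> pverts G"
  shows "Q_op G x v = l * x v"
proof -
  have fin: "finite (pverts G)" using G by (simp add: pair_graph_iff)
  define y where "y = (\<lambda>w. if w = v then 1 else 0 :: real)"
  have ip: "(\<Sum>w\<in>pverts G. f w * y w) = f v" for f :: "'a \<Rightarrow> real"
    using fin v by (simp add: y_def if_distrib cong: if_cong)
  have yy: "(\<Sum>w\<in>pverts G. (y w)\<^sup>2) = 1"
    using ip[of y] by (simp add: power2_eq_square y_def)
  have lin: "2 * t * (2 * l * x v) + t\<^sup>2 * (2 * l) \<ge> 2 * t * Q_form G x y + t\<^sup>2 * Q_form G y y" for t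
  proof -
    have "(\<Sum>w\<in>pverts G. (x w + t * y w)\<^sup>2)
        = (\<Sum>w\<in>pverts G. (x w)\<^sup>2 + 2 * t * (x w * y w) + t\<^sup>2 * (y w)\<^sup>2)"
      by (simp add: power2_eq_square algebra_simps)
    also have "\<dots> = (\<Sum>w\<in>pverts G. (x w)\<^sup>2) + 2 * t * x v + t\<^sup>2"
      unfolding sum.distrib sum_distrib_left[symmetric] by (simp add: ip yy)
    finally show ?thesis
      using le[of "\<lambda>w. x w + t * y w"] eq unfolding Q_form_add_scaled
      by (simp add: algebra_simps)
  qed
  have "t * (4 * l * x v - 2 * Q_form G x y) + t\<^sup>2 * (2 * l - Q_form G y y) \<ge> 0" for t
    using lin[of t] by (simp add: algebra_simps)
  then have "4 * l * x v - 2 * Q_form G x y = 0"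
    by (rule linear_coeff_zero)
  then show ?thesis
    using Q_form_eq[OF G, of x y] ip[of "Q_op G x"] by simp
qed

text \<open>The maximum \<open>l\<close> of the Rayleigh quotient is an eigenvalue, since the
  maximizer is an eigenfunction. Every eigenvalue is the quotient at its own eigenfunction, hence at
  most \<open>l\<close>.\<close>

lemma
  assumes G: "pair_graph G" and ne: "pverts G \<noteq> {}"
  shows Q_form_le_q1: "Q_form G y y \<le> 2 * q1 G * (\<Sum>v\<in>pverts G. (y v)\<^sup>2)"
    and q1_attained: "\<exists>x. (\<exists>v\<in>pverts G. x v \<noteq> 0) \<and> Q_form G x x = 2 * q1 G * (\<Sum>v\<in>pverts G. (x v)\<^sup>2)"
proof -
  have fin: "finite (pverts G)" using G by (simp add: pair_graph_iff)
  obtain x l where x: "\<exists>v\<in>pverts G. x v \<noteq> 0"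
    and eq: "Q_form G x x = 2 * l * (\<Sum>v\<in>pverts G. (x v)\<^sup>2)"
    and le: "\<And>y. Q_form G y y \<le> 2 * l * (\<Sum>v\<in>pverts G. (y v)\<^sup>2)"
    using Q_form_maximizer_exists[OF G ne] by metis
  obtain vs where vs: "enumerates vs G"
    using finite_distinct_list[OF fin] by (auto simp: enumerates_def)
  note sp = spectrum_signless_laplacian[OF G vs]
  have "q1 G = l"
    unfolding q1_eq[OF vs]
  proof (rule Max_eqI)
    show "finite (spectrum (signless_laplacian G vs))"
      by (rule card_finite_spectrum(1)[of _ "length vs"])
        (auto simp: signless_laplacian_def degree_mat_def adjacency_mat_def)
    show "l \<in> spectrum (signless_laplacian G vs)"
      unfolding sp using x Q_form_maximizer_eigen[OF G eq le] by blast
    fix a assume "a \<in> spectrum (signless_laplacian G vs)"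
    then obtain z where z: "\<exists>v\<in>pverts G. z v \<noteq> 0" "\<forall>v\<in>pverts G. Q_op G z v = a * z v"
      unfolding sp by blast
    have "Q_form G z z = 2 * (\<Sum>v\<in>pverts G. a * (z v)\<^sup>2)"
      unfolding Q_form_eq[OF G] using z by (simp add: power2_eq_square mult.assoc)
    then have "2 * a * (\<Sum>v\<in>pverts G. (z v)\<^sup>2) \<le> 2 * l * (\<Sum>v\<in>pverts G. (z v)\<^sup>2)"
      using le[of z] by (simp add: sum_distrib_left mult.assoc)
    moreover have "(\<Sum>v\<in>pverts G. (z v)\<^sup>2) > 0"
      using z(1) fin by (auto intro: sum_pos2)
    ultimately show "a \<le> l" by simp
  qed
  then show "Q_form G y y \<le> 2 * q1 G * (\<Sum>v\<in>pverts G. (y v)\<^sup>2)"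
    and "\<exists>x. (\<exists>v\<in>pverts G. x v \<noteq> 0) \<and> Q_form G x x = 2 * q1 G * (\<Sum>v\<in>pverts G. (x v)\<^sup>2)"
    using x eq le by auto
qed

section \<open>Isomorphism invariance\<close>

definition map_graph :: "('a \<Rightarrow> 'b) \<Rightarrow> 'a pair_pre_digraph \<Rightarrow> 'b pair_pre_digraph" where
  "map_graph f G = \<lparr>pverts = f ` pverts G, parcs = map_prod f f ` parcs G\<rparr>"

lemma pverts_map_graph [simp]: "pverts (map_graph f G) = f ` pverts G"
  and parcs_map_graph [simp]: "parcs (map_graph f G) = map_prod f f ` parcs G"
  by (simp_all add: map_graph_def)

lemma pair_graph_map_graph:
  assumes "pair_graph G" "inj_on f (pverts G)"
  shows "pair_graph (map_graph f G)"
  using assms unfolding pair_graph_iff by (fastforce simp: inj_on_def)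

text \<open>Arcs are pairs of vertices, so the arc component of an isomorphism is forced by its
  vertex component.\<close>

lemma digraph_iso_iff:
  assumes "pair_graph G"
  shows "digraph_iso (with_proj G) (with_proj H) \<longleftrightarrow> (\<exists>f. inj_on f (pverts G) \<and> H = map_graph f G)"
proof
  assume "digraph_iso (with_proj G) (with_proj H)"
  then obtain h where h: "pre_digraph.digraph_isomorphism (with_proj G) h"
    and H: "with_proj H = app_iso h (with_proj G)"
    by (auto simp: digraph_iso_def)
  define f where "f = iso_verts h"
  have t: "iso_tail h = fst" "iso_head h = snd"
    using H by (auto simp: with_proj_def app_iso_def)
  have a: "iso_arcs h e = map_prod f f e" if "e \<in> parcs G" for e
    using h that t by (auto simp: pre_digraph.digraph_isomorphism_def f_def prod_eq_iff)
  have "pverts H = f ` pverts G" "parcs H = iso_arcs h ` parcs G"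
    using H by (auto simp: with_proj_def app_iso_def f_def)
  then have "H = map_graph f G"
    using a by (auto simp: map_graph_def)
  moreover have "inj_on f (pverts G)"
    using h by (simp add: pre_digraph.digraph_isomorphism_def f_def)
  ultimately show "\<exists>f. inj_on f (pverts G) \<and> H = map_graph f G" by blast
next
  assume "\<exists>f. inj_on f (pverts G) \<and> H = map_graph f G"
  then obtain f where f: "inj_on f (pverts G)" and H: "H = map_graph f G" by blast
  define h where "h = \<lparr>iso_verts = f, iso_arcs = map_prod f f, iso_head = snd, iso_tail = fst\<rparr>"
  interpret pair_graph G by fact
  have "parcs G \<subseteq> pverts G \<times> pverts G"
    using assms by (simp add: pair_graph_iff)
  then have "inj_on (map_prod f f) (parcs G)"
    using map_prod_inj_on[OF f f] inj_on_subset by blast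
  then have "pre_digraph.digraph_isomorphism (with_proj G) h"
    using f wf_digraph_axioms by (simp add: pre_digraph.digraph_isomorphism_def h_def)
  moreover have "with_proj H = app_iso h (with_proj G)"
    by (simp add: H h_def app_iso_def with_proj_def map_graph_def)
  ultimately show "digraph_iso (with_proj G) (with_proj H)"
    unfolding digraph_iso_def by blast
qed

lemma q1_geI:
  assumes G: "pair_graph G" and ne: "\<exists>v\<in>pverts G. y v \<noteq> 0"
    and ge: "2 * l * (\<Sum>v\<in>pverts G. (y v)\<^sup>2) \<le> Q_form G y y"
  shows "l \<le> q1 G"
proof -
  have "pverts G \<noteq> {}" using ne by auto
  then have "l * (\<Sum>v\<in>pverts G. (y v)\<^sup>2) \<le> q1 G * (\<Sum>v\<in>pverts G. (y v)\<^sup>2)"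
    using Q_form_le_q1[OF G, of y] ge by simp
  moreover have "(\<Sum>v\<in>pverts G. (y v)\<^sup>2) > 0"
    using ne G by (auto intro: sum_pos2 simp: pair_graph_iff)
  ultimately show ?thesis by simp
qed

text \<open>Trial functions can be carried along \<open>f\<close> in both directions without
  changing form or norm, which gives the two inequalities.\<close>

lemma q1_map_graph:
  assumes G: "pair_graph G" and ne: "pverts G \<noteq> {}" and inj: "inj_on f (pverts G)"
  shows "q1 (map_graph f G) = q1 G"
proof -
  let ?H = "map_graph f G"
  have H: "pair_graph ?H" "pverts ?H \<noteq> {}"
    using pair_graph_map_graph[OF G inj] ne by auto
  have E: "parcs G \<subseteq> pverts G \<times> pverts G" using G by (simp add: pair_graph_iff)
  have "inj_on (map_prod f f) (parcs G)"
    using map_prod_inj_on[OF inj inj] E inj_on_subset by blast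
  then have form: "Q_form ?H y y = Q_form G (y \<circ> f) (y \<circ> f)" for y
    by (simp add: Q_form_def sum.reindex case_prod_beta)
  have norm: "(\<Sum>v\<in>pverts ?H. (y v)\<^sup>2) = (\<Sum>v\<in>pverts G. ((y \<circ> f) v)\<^sup>2)" for y :: "'b \<Rightarrow> real"
    using inj by (simp add: sum.reindex)
  show ?thesis
  proof (rule antisym)
    obtain y where y: "\<exists>v\<in>pverts ?H. y v \<noteq> 0"
        "Q_form ?H y y = 2 * q1 ?H * (\<Sum>v\<in>pverts ?H. (y v)\<^sup>2)"
      using q1_attained[OF H] by blast
    show "q1 ?H \<le> q1 G"
      using y unfolding form norm by (intro q1_geI[OF G, of "y \<circ> f"]) auto
    obtain x where x: "\<exists>v\<in>pverts G. x v \<noteq> 0"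
        "Q_form G x x = 2 * q1 G * (\<Sum>v\<in>pverts G. (x v)\<^sup>2)"
      using q1_attained[OF G ne] by blast
    define y where "y = x \<circ> the_inv_into (pverts G) f"
    have yf: "(y \<circ> f) v = x v" if "v \<in> pverts G" for v
      using the_inv_into_f_f[OF inj that] by (simp add: y_def)
    have "Q_form G (y \<circ> f) (y \<circ> f) = Q_form G x x"
      unfolding Q_form_def case_prod_beta using E yf by (intro sum.cong refl) fastforce
    moreover have "(\<Sum>v\<in>pverts ?H. (y v)\<^sup>2) = (\<Sum>v\<in>pverts G. (x v)\<^sup>2)"
      unfolding norm using yf by (intro sum.cong) simp_all
    moreover have "\<exists>v\<in>pverts ?H. y v \<noteq> 0"
    proof -
      obtain v where "v \<in> pverts G" "x v \<noteq> 0" using x(1) by blast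
      then show ?thesis using yf[of v] by (intro bexI[of _ "f v"]) simp_all
    qed
    ultimately show "q1 G \<le> q1 ?H"
      using x(2) by (intro q1_geI[OF H(1), of y]) (simp_all add: form)
  qed
qed

section \<open>The Perron vector and moving neighbours\<close>

text \<open>
  Connectedness, stated for the sets of vertices that are closed under adjacency, so that it
  applies directly to the zero set of a nonnegative eigenvector.
\<close>

definition linked :: "'a pair_pre_digraph \<Rightarrow> bool" where
  "linked G \<longleftrightarrow> (\<forall>Z\<subseteq>pverts G. Z \<noteq> {} \<longrightarrow> (\<forall>u\<in>Z. \<forall>v. (u, v) \<in> parcs G \<longrightarrow> v \<in> Z) \<longrightarrow> Z = pverts G)"

text \<open>Absolute values keep the norm and do not decrease the form, so they turn a maximizer
  into a nonnegative maximizer, again an eigenfunction. Its zero set is closed under adjacency,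
  hence empty.\<close>

lemma perron_vector:
  assumes G: "pair_graph G" and ne: "pverts G \<noteq> {}" and "linked G"
  obtains x where "\<And>v. v \<in> pverts G \<Longrightarrow> x v > 0"
    "\<And>v. v \<in> pverts G \<Longrightarrow> Q_op G x v = q1 G * x v"
    "Q_form G x x = 2 * q1 G * (\<Sum>v\<in>pverts G. (x v)\<^sup>2)"
proof -
  obtain z where z: "\<exists>v\<in>pverts G. z v \<noteq> 0"
      "Q_form G z z = 2 * q1 G * (\<Sum>v\<in>pverts G. (z v)\<^sup>2)"
    using q1_attained[OF G ne] by blast
  define x where "x v = \<bar>z v\<bar>" for v
  have "Q_form G z z \<le> Q_form G x x"
    unfolding Q_form_def case_prod_beta
  proof (rule sum_mono)
    fix e
    have "\<bar>z (fst e) + z (snd e)\<bar> * \<bar>z (fst e) + z (snd e)\<bar>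
        \<le> (x (fst e) + x (snd e)) * (x (fst e) + x (snd e))"
      by (rule mult_mono) (auto simp: x_def)
    then show "(z (fst e) + z (snd e)) * (z (fst e) + z (snd e))
        \<le> (x (fst e) + x (snd e)) * (x (fst e) + x (snd e))"
      by simp
  qed
  then have form: "Q_form G x x = 2 * q1 G * (\<Sum>v\<in>pverts G. (x v)\<^sup>2)"
    using Q_form_le_q1[OF G ne, of x] z(2) by (simp add: x_def)
  have eig: "Q_op G x v = q1 G * x v" if "v \<in> pverts G" for v
    using Q_form_maximizer_eigen[OF G form Q_form_le_q1[OF G ne] that] .
  define Z where "Z = {v \<in> pverts G. x v = 0}"
  have "w \<in> Z" if "v \<in> Z" "(v, w) \<in> parcs G" for v w
  proof -
    \<comment> \<open>At a zero of \<open>x\<close> the eigenvalue equation makes a sum of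
      nonnegative terms vanish, so all neighbours are zeros too.\<close>
    have "(\<Sum>w | (v, w) \<in> parcs G. x v + x w) = 0"
      using eig[of v] that by (simp add: Z_def Q_op_def)
    then have "x v + x w = 0"
      using that finite_nbhd[OF G] by (subst (asm) sum_nonneg_eq_0_iff) (auto simp: x_def)
    then show ?thesis
      using that G by (auto simp: x_def Z_def pair_graph_iff)
  qed
  moreover have "Z \<subseteq> pverts G" "Z \<noteq> pverts G"
    using z(1) by (auto simp: Z_def x_def)
  ultimately have "Z = {}"
    using \<open>linked G\<close> unfolding linked_def by blast
  then have "x v > 0" if "v \<in> pverts G" for v
    using that by (auto simp: Z_def x_def)
  then show ?thesis using eig form that by blast
qed

section \<open>Moving neighbours from one vertex to another\<close>

definition move :: "'a set \<Rightarrow> 'a \<Rightarrow> 'a \<Rightarrow> 'a pair_pre_digraph \<Rightarrow> 'a pair_pre_digraph" where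
  "move M u v G = \<lparr>pverts = pverts G,
     parcs = (parcs G - {u} \<times> M - M \<times> {u}) \<union> {v} \<times> M \<union> M \<times> {v}\<rparr>"

lemma pverts_move [simp]: "pverts (move M u v G) = pverts G"
  by (simp add: move_def)

lemma parcs_move:
  "parcs (move M u v G) = (parcs G - {u} \<times> M - M \<times> {u}) \<union> {v} \<times> M \<union> M \<times> {v}"
  by (simp add: move_def)

text \<open>Excluding \<open>v\<close> itself leaves a possible edge between \<open>u\<close> and
  \<open>v\<close> untouched by a move of such vertices.\<close>

definition private_nbhd :: "'a \<Rightarrow> 'a \<Rightarrow> 'a pair_pre_digraph \<Rightarrow> 'a set" where
  "private_nbhd u v G = {x. (u, x) \<in> parcs G \<and> (v, x) \<notin> parcs G \<and> x \<noteq> v}"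

lemma pair_graph_move:
  assumes "pair_graph G" "v \<in> pverts G" "M \<subseteq> private_nbhd u v G"
  shows "pair_graph (move M u v G)"
  using assms unfolding pair_graph_iff parcs_move pverts_move private_nbhd_def by auto

lemma Q_form_move:
  assumes G: "pair_graph G" and uv: "u \<noteq> v" and M: "M \<subseteq> private_nbhd u v G"
  shows "Q_form (move M u v G) x x
    = Q_form G x x + 2 * (\<Sum>m\<in>M. (x v + x m)\<^sup>2 - (x u + x m)\<^sup>2)"
proof -
  \<comment> \<open>The arcs common to both graphs. The old graph attaches the star on
    \<open>M\<close> at \<open>u\<close>, the new one at \<open>v\<close>; the two orientations of
    each star account for the factor 2.\<close>
  define R where "R = parcs G - {u} \<times> M - M \<times> {u}"
  define g where "g = (\<lambda>(a, b). (x a + x b) * (x a + x b))"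
  have fin: "finite (parcs G)"
    using G finite_subset[of "parcs G" "pverts G \<times> pverts G"] by (simp add: pair_graph_iff)
  have "M \<subseteq> pverts G" using G M by (auto simp: pair_graph_iff private_nbhd_def)
  then have finM: "finite M" using G by (auto simp: pair_graph_iff dest: finite_subset)
  have star: "sum g ({w} \<times> M) = (\<Sum>m\<in>M. (x w + x m)\<^sup>2)" "sum g (M \<times> {w}) = (\<Sum>m\<in>M. (x w + x m)\<^sup>2)" for w
  proof -
    have "{w} \<times> M = Pair w ` M" "M \<times> {w} = (\<lambda>m. (m, w)) ` M" by auto
    then show "sum g ({w} \<times> M) = (\<Sum>m\<in>M. (x w + x m)\<^sup>2)" "sum g (M \<times> {w}) = (\<Sum>m\<in>M. (x w + x m)\<^sup>2)"
      by (simp_all add: sum.reindex inj_on_def g_def power2_eq_square add.commute)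
  qed
  have split: "sum g (R \<union> {w} \<times> M \<union> M \<times> {w}) = sum g R + 2 * (\<Sum>m\<in>M. (x w + x m)\<^sup>2)"
    if "R \<inter> {w} \<times> M = {}" "R \<inter> M \<times> {w} = {}" "w \<notin> M" for w
  proof -
    have "finite R" using fin by (simp add: R_def)
    moreover have "(R \<union> {w} \<times> M) \<inter> M \<times> {w} = {}" using that by auto
    ultimately show ?thesis
      using that finM by (simp add: sum.union_disjoint star)
  qed
  have "u \<notin> M" "v \<notin> M" and priv: "(v, m) \<notin> parcs G" "(m, v) \<notin> parcs G" if "m \<in> M" for m
    using G M that by (auto simp: pair_graph_iff private_nbhd_def)
  then have nin: "u \<notin> M" "v \<notin> M" by blast+
  have "parcs G = R \<union> {u} \<times> M \<union> M \<times> {u}"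
    using G M by (auto simp: R_def pair_graph_iff private_nbhd_def)
  then have "Q_form G x x = sum g R + 2 * (\<Sum>m\<in>M. (x u + x m)\<^sup>2)"
    using split[of u] nin unfolding Q_form_def g_def[symmetric] by (auto simp: R_def)
  moreover have "Q_form (move M u v G) x x = sum g R + 2 * (\<Sum>m\<in>M. (x v + x m)\<^sup>2)"
    using split[of v] nin priv unfolding Q_form_def g_def[symmetric] parcs_move R_def[symmetric]
    by (auto simp: R_def)
  ultimately show ?thesis by (simp add: sum_subtractf)
qed

lemma Q_op_move_less:
  assumes G: "pair_graph G" and uv: "u \<noteq> v" and M: "M \<subseteq> private_nbhd u v G" "M \<noteq> {}"
    and pos: "\<And>v. v \<in> pverts G \<Longrightarrow> x v > 0"
  shows "Q_op (move M u v G) x u < Q_op G x u"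
proof -
  have "{w. (u, w) \<in> parcs (move M u v G)} = {w. (u, w) \<in> parcs G} - M"
    using G M uv by (auto simp: parcs_move private_nbhd_def pair_graph_iff)
  moreover have sub: "M \<subseteq> {w. (u, w) \<in> parcs G}"
    using M by (auto simp: private_nbhd_def)
  ultimately have "Q_op G x u = Q_op (move M u v G) x u + (\<Sum>w\<in>M. x u + x w)"
    unfolding Q_op_def using sum.subset_diff[OF sub finite_nbhd[OF G], of "\<lambda>w. x u + x w"] by simp
  moreover have "(\<Sum>w\<in>M. x u + x w) > 0"
  proof (rule sum_pos)
    show "finite M" using finite_subset[OF sub finite_nbhd[OF G]] .
    fix w assume "w \<in> M"
    then have "u \<in> pverts G" "w \<in> pverts G"
      using M G by (auto simp: pair_graph_iff private_nbhd_def)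
    then show "x u + x w > 0" using pos by (simp add: add_pos_pos)
  qed fact
  ultimately show ?thesis by simp
qed

text \<open>With the Perron vector of \<open>G\<close> as trial function, each moved edge
  contributes at least as much as before. Equality would make it an eigenfunction of the new graph
  for the same eigenvalue, but \<open>u\<close> has lost positive terms.\<close>

lemma move_increases_q1:
  assumes G: "pair_graph G" and uv: "u \<in> pverts G" "v \<in> pverts G" "u \<noteq> v"
    and M: "M \<subseteq> private_nbhd u v G" "M \<noteq> {}"
    and pos: "\<And>v. v \<in> pverts G \<Longrightarrow> x v > 0"
    and eig: "\<And>v. v \<in> pverts G \<Longrightarrow> Q_op G x v = q1 G * x v"
    and form: "Q_form G x x = 2 * q1 G * (\<Sum>v\<in>pverts G. (x v)\<^sup>2)"
    and le: "x u \<le> x v"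
  shows "q1 G < q1 (move M u v G)"
proof -
  let ?H = "move M u v G"
  have H: "pair_graph ?H" using pair_graph_move[OF G uv(2) M(1)] .
  have ne: "pverts ?H \<noteq> {}" using uv by auto
  have "(\<Sum>m\<in>M. (x v + x m)\<^sup>2 - (x u + x m)\<^sup>2) \<ge> 0"
  proof (rule sum_nonneg)
    fix m assume "m \<in> M"
    then have "m \<in> pverts G" using M G by (auto simp: pair_graph_iff private_nbhd_def)
    then show "(x v + x m)\<^sup>2 - (x u + x m)\<^sup>2 \<ge> 0"
      using pos[of m] pos[OF uv(1)] le by (simp add: power_mono)
  qed
  then have ge: "Q_form ?H x x \<ge> 2 * q1 G * (\<Sum>v\<in>pverts ?H. (x v)\<^sup>2)"
    using Q_form_move[OF G uv(3) M(1), of x] form by simp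
  have "q1 G \<le> q1 ?H"
    using q1_geI[OF H _ ge] uv pos by fastforce
  moreover have "q1 G \<noteq> q1 ?H"
  proof
    assume eq: "q1 G = q1 ?H"
    then have "Q_form ?H x x = 2 * q1 ?H * (\<Sum>v\<in>pverts ?H. (x v)\<^sup>2)"
      using ge Q_form_le_q1[OF H ne, of x] by simp
    then have "Q_op ?H x u = q1 ?H * x u"
      using Q_form_maximizer_eigen[OF H _ Q_form_le_q1[OF H ne]] uv by simp
    then show False
      using eig[OF uv(1)] eq Q_op_move_less[OF G uv(3) M, of x] pos by simp
  qed
  ultimately show ?thesis by simp
qed

text \<open>The vertex with the larger Perron entry should receive neighbours. \<open>M\<close> and
  \<open>L\<close> may be proper parts of the private neighbourhoods, as the transfer of some leaves
  in double stars requires.\<close>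

lemma move_either_increases_q1:
  assumes G: "pair_graph G" "linked G" and uv: "u \<in> pverts G" "v \<in> pverts G" "u \<noteq> v"
    and M: "M \<subseteq> private_nbhd u v G" "M \<noteq> {}" and L: "L \<subseteq> private_nbhd v u G" "L \<noteq> {}"
  shows "q1 G < q1 (move M u v G) \<or> q1 G < q1 (move L v u G)"
proof -
  have "pverts G \<noteq> {}" using uv by auto
  then obtain x where x: "\<And>v. v \<in> pverts G \<Longrightarrow> x v > 0"
    "\<And>v. v \<in> pverts G \<Longrightarrow> Q_op G x v = q1 G * x v"
    "Q_form G x x = 2 * q1 G * (\<Sum>v\<in>pverts G. (x v)\<^sup>2)"
    using perron_vector[OF G(1) _ G(2)] by metis
  show ?thesis
    using move_increases_q1[OF G(1) uv M x] move_increases_q1[OF G(1) uv(2,1) uv(3)[symmetric] L x]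
    by linarith
qed

section \<open>Shifting the whole private neighbourhood\<close>

definition shift :: "'a \<Rightarrow> 'a \<Rightarrow> 'a pair_pre_digraph \<Rightarrow> 'a pair_pre_digraph" where
  "shift u v G = move (private_nbhd u v G) u v G"

lemma pverts_shift [simp]: "pverts (shift u v G) = pverts G"
  by (simp add: shift_def)

lemma pair_graph_shift: "pair_graph G \<Longrightarrow> v \<in> pverts G \<Longrightarrow> pair_graph (shift u v G)"
  by (simp add: shift_def pair_graph_move)

lemma parcs_shift_iff:
  assumes "pair_graph G" "u \<noteq> v"
  shows "(a, b) \<in> parcs (shift u v G) \<longleftrightarrow>
    (if a = u then if b = v then (u, v) \<in> parcs G else (u, b) \<in> parcs G \<and> (v, b) \<in> parcs G
     else if a = v then if b = u then (u, v) \<in> parcs G else b \<noteq> v \<and> ((u, b) \<in> parcs G \<or> (v, b) \<in> parcs G)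
     else if b = u then (a, u) \<in> parcs G \<and> (a, v) \<in> parcs G
     else if b = v then (a, u) \<in> parcs G \<or> (a, v) \<in> parcs G
     else (a, b) \<in> parcs G)"
proof -
  have irr: "(x, x) \<notin> parcs G" and sym: "(x, y) \<in> parcs G \<longleftrightarrow> (y, x) \<in> parcs G" for x y
    using assms(1) unfolding pair_graph_iff by blast+
  show ?thesis
    unfolding shift_def parcs_move private_nbhd_def
    by (cases "a = u"; cases "a = v"; cases "b = u"; cases "b = v")
      (use assms(2) irr sym[of u a] sym[of v a] in auto)
qed

text \<open>Apart from \<open>u\<close> and \<open>v\<close> themselves, either shift gives one of
  the two vertices the union and the other the intersection of their neighbourhoods; only the names
  are exchanged.\<close>

lemma shift_swap:
  assumes G: "pair_graph G" and uv: "u \<in> pverts G" "v \<in> pverts G" "u \<noteq> v"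
  shows "shift v u G = map_graph (Transposition.transpose u v) (shift u v G)"
proof -
  have irr: "(x, x) \<notin> parcs G" and sym: "(x, y) \<in> parcs G \<longleftrightarrow> (y, x) \<in> parcs G" for x y
    using G unfolding pair_graph_iff by blast+
  have "(a, b) \<in> parcs (shift v u G) \<longleftrightarrow> (Transposition.transpose u v a, Transposition.transpose u v b) \<in> parcs (shift u v G)" for a b
    unfolding parcs_shift_iff[OF G uv(3)] parcs_shift_iff[OF G uv(3)[symmetric]]
    by (cases "a = u"; cases "a = v"; cases "b = u"; cases "b = v")
      (use uv irr sym[of u v] in \<open>simp_all add: transpose_def conj_commute disj_commute\<close>)
  moreover have "(a, b) \<in> map_prod (Transposition.transpose u v) (Transposition.transpose u v) ` E \<longleftrightarrow>
      (Transposition.transpose u v a, Transposition.transpose u v b) \<in> E" for a b E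
    by (force simp: image_iff)
  ultimately have "parcs (shift v u G) = parcs (map_graph (Transposition.transpose u v) (shift u v G))"
    by auto
  moreover have "Transposition.transpose u v ` pverts G = pverts G"
    using uv by simp
  ultimately show ?thesis
    by (simp add: map_graph_def pair_pre_digraph.equality)
qed

lemma shift_increases_q1:
  assumes G: "pair_graph G" "linked G" and uv: "u \<in> pverts G" "v \<in> pverts G" "u \<noteq> v"
    and ne: "private_nbhd u v G \<noteq> {}" "private_nbhd v u G \<noteq> {}"
  shows "q1 G < q1 (shift u v G)"
proof -
  have "q1 (shift v u G) = q1 (shift u v G)"
    unfolding shift_swap[OF G(1) uv] using uv pair_graph_shift[OF G(1)]
    by (intro q1_map_graph) auto
  then show ?thesis
    using move_either_increases_q1[OF G uv order_refl ne(1) order_refl ne(2)] by (auto simp: shift_def)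
qed

section \<open>k-trees\<close>

lemma complete_iff:
  "K\<^bsub>k\<^esub> (with_proj G) \<longleftrightarrow> finite (pverts G) \<and> card (pverts G) = k \<and>
     parcs G = {(u, v). u \<in> pverts G \<and> v \<in> pverts G \<and> u \<noteq> v}"
  by (auto simp: complete_digraph_pair_def)

lemma pverts_join_vertex [simp]: "pverts (join_vertex w C G) = insert w (pverts G)"
  by (simp add: join_vertex_def)

lemma parcs_join_vertex_iff:
  "(a, b) \<in> parcs (join_vertex w C G) \<longleftrightarrow> (a, b) \<in> parcs G \<or> a = w \<and> b \<in> C \<or> a \<in> C \<and> b = w"
  by (auto simp: join_vertex_def)

lemma graph_eqI:
  fixes G H :: "'a pair_pre_digraph"
  assumes "pverts G = pverts H" "\<And>a b. (a, b) \<in> parcs G \<longleftrightarrow> (a, b) \<in> parcs H"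
  shows "G = H"
proof -
  have "parcs G = parcs H" using assms(2) by auto
  then show ?thesis using assms(1) by (simp add: pair_pre_digraph.equality)
qed

lemma k_tree_pair_graph: "k_tree k G \<Longrightarrow> pair_graph G"
proof (induction rule: k_tree.induct)
  case (complete G)
  then show ?case by (auto simp: complete_iff pair_graph_iff)
next
  case (join G C v)
  then show ?case
    by (auto simp: pair_graph_iff clique_def join_vertex_def)
qed

lemma k_tree_map_graph:
  "k_tree k G \<Longrightarrow> inj_on f (pverts G) \<Longrightarrow> k_tree k (map_graph f G)"
proof (induction rule: k_tree.induct)
  case (complete G)
  have E: "parcs G = {(u, v). u \<in> pverts G \<and> v \<in> pverts G \<and> u \<noteq> v}"
    using complete by (simp add: complete_iff)
  have "map_prod f f ` parcs G = {(u, v). u \<in> f ` pverts G \<and> v \<in> f ` pverts G \<and> u \<noteq> v}"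
    unfolding E using inj_on_eq_iff[OF complete(2)] by fast
  then show ?case
    using complete by (intro k_tree.complete) (simp add: complete_iff card_image)
next
  case (join G C v)
  have C: "C \<subseteq> pverts G" using join by (simp add: clique_def)
  have "map_graph f (join_vertex v C G) = join_vertex (f v) (f ` C) (map_graph f G)"
    by (auto simp: map_graph_def join_vertex_def)
  moreover have "k_tree k (join_vertex (f v) (f ` C) (map_graph f G))"
  proof (rule k_tree.join)
    show "k_tree k (map_graph f G)" using join by auto
    show "clique (map_graph f G) (f ` C)"
      unfolding clique_def
    proof (intro conjI ballI impI)
      show "f ` C \<subseteq> pverts (map_graph f G)" using C by auto
      fix a b assume "a \<in> f ` C" "b \<in> f ` C" "a \<noteq> b"
      then obtain x y where xy: "x \<in> C" "y \<in> C" "x \<noteq> y" "a = f x" "b = f y" by auto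
      then have "(x, y) \<in> parcs G" using join(2) by (simp add: clique_def)
      then have "map_prod f f (x, y) \<in> map_prod f f ` parcs G" by (rule imageI)
      then show "(a, b) \<in> parcs (map_graph f G)" using xy by simp
    qed
    show "card (f ` C) = k" using join(3) card_image[OF inj_on_subset[OF join.prems]] C by auto
    show "f v \<notin> pverts (map_graph f G)" using join.prems join(4) inj_on_image_mem_iff[OF join.prems, of v "pverts G"] by auto
  qed
  ultimately show ?case by simp
qed

lemma linkedI:
  assumes "\<And>Z. Z \<subseteq> pverts G \<Longrightarrow> Z \<noteq> {} \<Longrightarrow> (\<And>a b. a \<in> Z \<Longrightarrow> (a, b) \<in> parcs G \<Longrightarrow> b \<in> Z) \<Longrightarrow> pverts G \<subseteq> Z"
  shows "linked G"
  unfolding linked_def using assms by (meson subset_antisym)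

lemma linkedD:
  assumes "linked G" "Z \<subseteq> pverts G" "Z \<noteq> {}" "\<And>a b. a \<in> Z \<Longrightarrow> (a, b) \<in> parcs G \<Longrightarrow> b \<in> Z"
  shows "Z = pverts G"
  using assms unfolding linked_def by meson

text \<open>As \<open>k\<close> is positive, a joined vertex has an old neighbour. A nonempty closed
  set therefore meets the old graph, contains it by induction, and then reaches the new
  vertex.\<close>

lemma k_tree_linked:
  assumes "k \<ge> 1"
  shows "k_tree k G \<Longrightarrow> linked G"
proof (induction rule: k_tree.induct)
  case (complete G)
  then have E: "parcs G = {(u, v). u \<in> pverts G \<and> v \<in> pverts G \<and> u \<noteq> v}"
    by (simp add: complete_iff)
  show ?case
  proof (rule linkedI, rule subsetI)
    fix Z v assume Z: "Z \<subseteq> pverts G" "Z \<noteq> {}" and cl: "\<And>a b. a \<in> Z \<Longrightarrow> (a, b) \<in> parcs G \<Longrightarrow> b \<in> Z"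
      and v: "v \<in> pverts G"
    obtain z where "z \<in> Z" using Z by blast
    then show "v \<in> Z" using cl[of z v] Z v by (cases "z = v") (auto simp: E)
  qed
next
  case (join G C w)
  have CP: "C \<subseteq> pverts G" using join by (simp add: clique_def)
  have "C \<noteq> {}" using join(3) assms by auto
  then obtain c where c: "c \<in> C" "c \<in> pverts G" using CP by blast
  have wf: "a \<in> pverts G \<and> b \<in> pverts G" if "(a, b) \<in> parcs G" for a b
    using that k_tree_pair_graph[OF join(1)] unfolding pair_graph_iff by blast
  show ?case
  proof (rule linkedI)
    fix Z assume Z: "Z \<subseteq> pverts (join_vertex w C G)" "Z \<noteq> {}"
      and cl: "\<And>a b. a \<in> Z \<Longrightarrow> (a, b) \<in> parcs (join_vertex w C G) \<Longrightarrow> b \<in> Z"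
    have "c \<in> Z" if "w \<in> Z"
      using cl[OF that, of c] c by (simp add: parcs_join_vertex_iff)
    then have "Z \<inter> pverts G \<noteq> {}" using Z c by auto
    then have "Z \<inter> pverts G = pverts G"
    proof (rule linkedD[OF join.IH Int_lower2])
      fix a b assume "a \<in> Z \<inter> pverts G" "(a, b) \<in> parcs G"
      then show "b \<in> Z \<inter> pverts G" using cl[of a b] wf[of a b] by (simp add: parcs_join_vertex_iff)
    qed
    then have "pverts G \<subseteq> Z" by blast
    moreover from this have "w \<in> Z"
      using cl[of c w] c by (auto simp: parcs_join_vertex_iff)
    ultimately show "pverts (join_vertex w C G) \<subseteq> Z" by simp
  qed
qed

text \<open>No 4-cycle is induced: the neighbours of a newly joined vertex form a clique, so a
  4-cycle through it has a chord, and any other 4-cycle lies in the smaller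
  \<open>k\<close>-tree.\<close>

lemma k_tree_chord:
  "k_tree k G \<Longrightarrow> (a, b) \<in> parcs G \<Longrightarrow> (b, c) \<in> parcs G \<Longrightarrow> (c, d) \<in> parcs G \<Longrightarrow> (d, a) \<in> parcs G
    \<Longrightarrow> a \<noteq> c \<Longrightarrow> b \<noteq> d \<Longrightarrow> (a, c) \<in> parcs G \<or> (b, d) \<in> parcs G"
proof (induction arbitrary: a b c d rule: k_tree.induct)
  case (complete G)
  then show ?case by (auto simp: complete_iff)
next
  case (join G C v)
  have v: "(v, x) \<notin> parcs G" "(x, v) \<notin> parcs G" "v \<notin> C" for x
    using join k_tree_pair_graph[OF join(1)] by (auto simp: pair_graph_iff clique_def)
  have C: "(x, y) \<in> parcs G" if "x \<in> C" "y \<in> C" "x \<noteq> y" for x y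
    using join that by (auto simp: clique_def)
  show ?case
    using join.prems unfolding parcs_join_vertex_iff
    by (cases "a = v"; cases "b = v"; cases "c = v"; cases "d = v"; use v C join.IH[of a b c d] in auto)
qed

text \<open>Induction on the construction. If the last vertex \<open>w\<close> takes part in the
  shift, the result is a relabelling of the same graph; otherwise \<open>w\<close> can be joined
  after shifting the smaller \<open>k\<close>-tree.\<close>

lemma k_tree_shift:
  "k_tree k G \<Longrightarrow> (u, v) \<in> parcs G \<Longrightarrow> k_tree k (shift u v G)"
proof (induction arbitrary: u v rule: k_tree.induct)
  case (complete G)
  have "shift u v G = G"
    using complete by (intro graph_eqI) (auto simp: shift_def parcs_move private_nbhd_def complete_iff)
  then show ?case using complete by (simp add: k_tree.complete)
next
  case (join G C w)
  let ?J = "join_vertex w C G"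
  have J: "k_tree k ?J" using join by (intro k_tree.join)
  have pJ: "pair_graph ?J" and pG: "pair_graph G"
    using k_tree_pair_graph J join by blast+
  have uvP: "u \<in> pverts ?J" "v \<in> pverts ?J" "u \<noteq> v"
    using join.prems pJ unfolding pair_graph_iff by blast+
  have CP: "C \<subseteq> pverts G" and Cadj: "\<And>x y. x \<in> C \<Longrightarrow> y \<in> C \<Longrightarrow> x \<noteq> y \<Longrightarrow> (x, y) \<in> parcs G"
    using join by (auto simp: clique_def)
  have wG: "(w, x) \<notin> parcs G" "(x, w) \<notin> parcs G" for x
    using join pG by (auto simp: pair_graph_iff)
  have wC: "w \<notin> C" using join CP by blast
  \<comment> \<open>The neighbours of \<open>w\<close> form a clique, so \<open>w\<close> has no
    private neighbour against an adjacent vertex.\<close>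
  have leaf: "shift w y ?J = ?J" if "(w, y) \<in> parcs ?J" for y
  proof -
    have "private_nbhd w y ?J = {}"
      using that Cadj wG by (auto simp: private_nbhd_def parcs_join_vertex_iff)
    then show ?thesis by (simp add: shift_def move_def)
  qed
  consider "u = w" | "v = w" | "u \<noteq> w" "v \<noteq> w" by blast
  then show ?case
  proof cases
    case 1
    then show ?thesis using leaf join.prems J by simp
  next
    case 2
    have "(v, u) \<in> parcs ?J" using join.prems pJ by (auto simp: pair_graph_iff)
    then have "shift v u ?J = ?J" using leaf 2 by simp
    moreover have "shift u v ?J = map_graph (Transposition.transpose v u) (shift v u ?J)"
      using shift_swap[OF pJ uvP(2,1) uvP(3)[symmetric]] .
    ultimately show ?thesis
      using k_tree_map_graph[OF J inj_on_transpose, of v u] by simp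
  next
    case 3
    have uv: "(u, v) \<in> parcs G" using join.prems 3 by (auto simp: parcs_join_vertex_iff)
    have uvG: "u \<in> pverts G" "v \<in> pverts G" using uv pG by (auto simp: pair_graph_iff)
    \<comment> \<open>The neighbourhood of \<open>w\<close> after the shift: \<open>v\<close> takes
      the place of \<open>u\<close> unless it was there already. It remains a clique because
      \<open>v\<close> inherits the neighbours of \<open>u\<close>.\<close>
    define C' where "C' = (if u \<in> C \<and> v \<notin> C then insert v (C - {u}) else C)"
    have "shift u v ?J = join_vertex w C' (shift u v G)"
    proof (rule graph_eqI)
      fix a b
      show "(a, b) \<in> parcs (shift u v ?J) \<longleftrightarrow> (a, b) \<in> parcs (join_vertex w C' (shift u v G))"
        unfolding parcs_shift_iff[OF pJ uvP(3)] parcs_join_vertex_iff parcs_shift_iff[OF pG uvP(3)]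
        by (cases "a = u"; cases "a = v"; cases "a = w"; cases "b = u"; cases "b = v"; cases "b = w";
            use 3 uvP(3) wC in \<open>auto simp: C'_def wG\<close>)
    qed simp
    moreover have "k_tree k (join_vertex w C' (shift u v G))"
    proof (rule k_tree.join)
      show "k_tree k (shift u v G)" using join.IH uv .
      show "clique (shift u v G) C'"
        unfolding clique_def
      proof (intro conjI ballI impI)
        show "C' \<subseteq> pverts (shift u v G)" using CP uvG by (auto simp: C'_def)
        fix x y assume "x \<in> C'" "y \<in> C'" "x \<noteq> y"
        then show "(x, y) \<in> parcs (shift u v G)"
          unfolding parcs_shift_iff[OF pG uvP(3)] using Cadj uv
          by (auto simp: C'_def split: if_splits)
      qed
      have "finite C" using CP pG by (auto simp: pair_graph_iff dest: finite_subset)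
      then show "card C' = k" using join(3)
        using card_Suc_Diff1[of C u] by (auto simp: C'_def)
      show "w \<notin> pverts (shift u v G)" using join by simp
    qed
    ultimately show ?thesis by simp
  qed
qed

section \<open>Joins with a complete graph\<close>

text \<open>\<open>R\<close> is symmetrised and freed of loops, so the edges inside \<open>W\<close>
  can be listed in one direction only.\<close>

definition cone :: "'a set \<Rightarrow> 'a set \<Rightarrow> ('a \<Rightarrow> 'a \<Rightarrow> bool) \<Rightarrow> 'a pair_pre_digraph" where
  "cone C W R = \<lparr>pverts = C \<union> W,
     parcs = {(x, y). x \<noteq> y \<and> x \<in> C \<union> W \<and> y \<in> C \<union> W \<and> (x \<in> C \<or> y \<in> C \<or> R x y \<or> R y x)}\<rparr>"

lemma pverts_cone [simp]: "pverts (cone C W R) = C \<union> W"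
  by (simp add: cone_def)

lemma parcs_cone_iff:
  "(x, y) \<in> parcs (cone C W R) \<longleftrightarrow>
     x \<noteq> y \<and> x \<in> C \<union> W \<and> y \<in> C \<union> W \<and> (x \<in> C \<or> y \<in> C \<or> R x y \<or> R y x)"
  by (simp add: cone_def)

lemma pair_graph_cone: "finite C \<Longrightarrow> finite W \<Longrightarrow> pair_graph (cone C W R)"
  unfolding pair_graph_iff by (auto simp: cone_def)

lemma parcs_map_graph_iff:
  assumes "pair_graph G" "inj_on f (pverts G)" "x \<in> pverts G" "y \<in> pverts G"
  shows "(f x, f y) \<in> parcs (map_graph f G) \<longleftrightarrow> (x, y) \<in> parcs G"
proof
  assume "(f x, f y) \<in> parcs (map_graph f G)"
  then obtain x' y' where "(x', y') \<in> parcs G" "f x = f x'" "f y = f y'" by auto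
  moreover from this have "x' \<in> pverts G" "y' \<in> pverts G"
    using assms(1) by (auto simp: pair_graph_iff)
  ultimately show "(x, y) \<in> parcs G"
    using assms by (metis inj_onD)
next
  assume "(x, y) \<in> parcs G"
  then have "map_prod f f (x, y) \<in> map_prod f f ` parcs G" by (rule imageI)
  then show "(f x, f y) \<in> parcs (map_graph f G)" by simp
qed

lemma map_graph_cone:
  assumes fin: "finite C" "finite W" and inj: "inj_on f (C \<union> W)"
    and R: "\<And>x y. x \<in> W \<Longrightarrow> y \<in> W \<Longrightarrow> R' (f x) (f y) \<longleftrightarrow> R x y"
  shows "map_graph f (cone C W R) = cone (f ` C) (f ` W) R'"
proof (rule graph_eqI)
  let ?G = "cone C W R"
  have G: "pair_graph ?G" using fin by (rule pair_graph_cone)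
  show "pverts (map_graph f ?G) = pverts (cone (f ` C) (f ` W) R')" by (simp add: image_Un)
  fix a b
  show "(a, b) \<in> parcs (map_graph f ?G) \<longleftrightarrow> (a, b) \<in> parcs (cone (f ` C) (f ` W) R')"
  proof (cases "a \<in> f ` (C \<union> W) \<and> b \<in> f ` (C \<union> W)")
    case True
    then obtain x y where xy: "x \<in> C \<union> W" "y \<in> C \<union> W" "a = f x" "b = f y" by blast
    have "f x \<in> f ` C \<longleftrightarrow> x \<in> C" "f y \<in> f ` C \<longleftrightarrow> y \<in> C" "f x = f y \<longleftrightarrow> x = y"
      using xy inj by (auto simp: inj_on_eq_iff inj_on_image_mem_iff[OF inj])
    moreover have "f x \<in> f ` C \<union> f ` W" "f y \<in> f ` C \<union> f ` W" using xy by auto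
    ultimately have "(f x, f y) \<in> parcs (cone (f ` C) (f ` W) R') \<longleftrightarrow> (x, y) \<in> parcs ?G"
      using xy R unfolding parcs_cone_iff by blast
    then show ?thesis using parcs_map_graph_iff[OF G, of f x y] inj xy by simp
  next
    case False
    have "(a, b) \<notin> parcs (map_graph f ?G)"
    proof
      assume "(a, b) \<in> parcs (map_graph f ?G)"
      then obtain x y where "(x, y) \<in> parcs ?G" "a = f x" "b = f y" by auto
      then show False using False by (auto simp: parcs_cone_iff)
    qed
    moreover have "(a, b) \<notin> parcs (cone (f ` C) (f ` W) R')"
      using False by (auto simp: parcs_cone_iff image_Un)
    ultimately show ?thesis by simp
  qed
qed

section \<open>Stars and double stars\<close>

abbreviation star_graph :: "'a set \<Rightarrow> 'a set \<Rightarrow> 'a pair_pre_digraph" where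
  "star_graph K L \<equiv> cone K L (\<lambda>_ _. False)"

text \<open>
  The join of the complete graph on \<open>C\<close> with the double star that has centres \<open>p\<close>, \<open>q\<close> with
  leaves \<open>A\<close>, \<open>B\<close>. For \<open>card C = k - 1\<close>, the graphs \<open>G\<^sub>1\<close> and \<open>G\<^sub>2\<close> are the cases \<open>card B = 1\<close>
  and \<open>card B = 2\<close>.
\<close>

definition double_star :: "'a set \<Rightarrow> 'a \<Rightarrow> 'a \<Rightarrow> 'a set \<Rightarrow> 'a set \<Rightarrow> 'a pair_pre_digraph" where
  "double_star C p q A B =
     cone C ({p, q} \<union> A \<union> B) (\<lambda>x y. x = p \<and> y \<in> insert q A \<or> x = q \<and> y \<in> B)"

definition double_star_data :: "'a set \<Rightarrow> 'a \<Rightarrow> 'a \<Rightarrow> 'a set \<Rightarrow> 'a set \<Rightarrow> bool" where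
  "double_star_data C p q A B \<longleftrightarrow> finite C \<and> finite A \<and> finite B \<and> p \<noteq> q \<and>
     p \<notin> C \<union> A \<union> B \<and> q \<notin> C \<union> A \<union> B \<and> C \<inter> A = {} \<and> C \<inter> B = {} \<and> A \<inter> B = {}"

lemma pverts_double_star [simp]: "pverts (double_star C p q A B) = C \<union> ({p, q} \<union> A \<union> B)"
  by (simp add: double_star_def)

lemma pair_graph_double_star: "double_star_data C p q A B \<Longrightarrow> pair_graph (double_star C p q A B)"
  unfolding double_star_def by (rule pair_graph_cone) (auto simp: double_star_data_def)

lemma double_star_commute: "double_star C p q A B = double_star C q p B A"
  by (rule graph_eqI) (auto simp: double_star_def parcs_cone_iff)

lemma double_star_data_commute: "double_star_data C p q A B \<Longrightarrow> double_star_data C q p B A"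
  by (auto simp: double_star_data_def)

lemma card_double_star:
  assumes "double_star_data C p q A B"
  shows "card (pverts (double_star C p q A B)) = card C + 2 + card A + card B"
proof -
  have "card ({p, q} \<union> A \<union> B) = 2 + card A + card B"
    using assms by (simp add: double_star_data_def card_Un_disjoint Int_Un_distrib2)
  moreover have "C \<inter> ({p, q} \<union> A \<union> B) = {}"
    using assms by (auto simp: double_star_data_def)
  ultimately show ?thesis
    using assms by (subst pverts_double_star, subst card_Un_disjoint) (auto simp: double_star_data_def)
qed

lemma star_graph_iso:
  assumes "finite K" "finite L" "K \<inter> L = {}" "finite K'" "finite L'" "K' \<inter> L' = {}"
    and "card K = card K'" "card L = card L'"
  shows "\<exists>f. inj_on f (K \<union> L) \<and> star_graph K' L' = map_graph f (star_graph K L)"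
proof -
  obtain g h where g: "bij_betw g K K'" and h: "bij_betw h L L'"
    using assms finite_same_card_bij by metis
  define f where "f x = (if x \<in> K then g x else h x)" for x
  have f: "bij_betw f K K'" "bij_betw f L L'"
  proof -
    have "f x = g x" if "x \<in> K" for x using that by (simp add: f_def)
    moreover have "f x = h x" if "x \<in> L" for x using that assms(3) by (auto simp: f_def)
    ultimately show "bij_betw f K K'" "bij_betw f L L'"
      using g h bij_betw_cong[of K f g] bij_betw_cong[of L f h] by auto
  qed
  then have "bij_betw f (K \<union> L) (K' \<union> L')"
    using assms(6) by (rule bij_betw_combine)
  then have inj: "inj_on f (K \<union> L)" by (simp add: bij_betw_def)
  moreover have "map_graph f (star_graph K L) = star_graph (f ` K) (f ` L)"
    by (rule map_graph_cone[OF assms(1,2) inj]) simp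
  ultimately show ?thesis using f by (auto simp: bij_betw_def)
qed

lemma double_star_iso:
  assumes d: "double_star_data C p q A B" "double_star_data C' p' q' A' B'"
    and card: "card C = card C'" "card A = card A'" "card B = card B'"
  shows "\<exists>f. inj_on f (pverts (double_star C p q A B)) \<and>
    double_star C' p' q' A' B' = map_graph f (double_star C p q A B)"
proof -
  have fin: "finite C" "finite A" "finite B" "finite C'" "finite A'" "finite B'"
    using d by (auto simp: double_star_data_def)
  obtain g h1 h2 where g: "bij_betw g C C'" and h1: "bij_betw h1 A A'" and h2: "bij_betw h2 B B'"
    using fin card finite_same_card_bij by metis
  define f where "f x = (if x = p then p' else if x = q then q' else if x \<in> C then g x
    else if x \<in> A then h1 x else h2 x)" for x
  have f: "bij_betw f C C'" "bij_betw f A A'" "bij_betw f B B'" "f p = p'" "f q = q'"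
  proof -
    have "f x = g x" if "x \<in> C" for x using that d(1) by (auto simp: f_def double_star_data_def)
    moreover have "f x = h1 x" if "x \<in> A" for x using that d(1) by (auto simp: f_def double_star_data_def)
    moreover have "f x = h2 x" if "x \<in> B" for x using that d(1) by (auto simp: f_def double_star_data_def)
    ultimately show "bij_betw f C C'" "bij_betw f A A'" "bij_betw f B B'"
      using g h1 h2 bij_betw_cong[of C f g] bij_betw_cong[of A f h1] bij_betw_cong[of B f h2] by auto
    show "f p = p'" "f q = q'" using d(1) by (auto simp: f_def double_star_data_def)
  qed
  have f0: "bij_betw f {p, q} {p', q'}" using f d by (auto simp: bij_betw_def double_star_data_def)
  have fA: "bij_betw f ({p, q} \<union> A) ({p', q'} \<union> A')"
    by (rule bij_betw_combine[OF f0 f(2)]) (use d(2) in \<open>auto simp: double_star_data_def\<close>)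
  have fB: "bij_betw f ({p, q} \<union> A \<union> B) ({p', q'} \<union> A' \<union> B')"
    by (rule bij_betw_combine[OF fA f(3)]) (use d(2) in \<open>auto simp: double_star_data_def\<close>)
  have bij: "bij_betw f (C \<union> ({p, q} \<union> A \<union> B)) (C' \<union> ({p', q'} \<union> A' \<union> B'))"
    by (rule bij_betw_combine[OF f(1) fB]) (use d(2) in \<open>auto simp: double_star_data_def\<close>)
  then have inj: "inj_on f (C \<union> ({p, q} \<union> A \<union> B))" by (simp add: bij_betw_def)
  have im: "f ` C = C'" "f ` A = A'" "f ` B = B'" using f by (auto simp: bij_betw_def)
  let ?W = "{p, q} \<union> A \<union> B"
  have "map_graph f (double_star C p q A B) = cone (f ` C) (f ` ?W)
      (\<lambda>x y. x = p' \<and> y \<in> insert q' A' \<or> x = q' \<and> y \<in> B')"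
    unfolding double_star_def
  proof (rule map_graph_cone[OF _ _ inj])
    show "finite C" "finite ?W" using fin by auto
    fix x y assume xy: "x \<in> ?W" "y \<in> ?W"
    have mem: "f z \<in> f ` S \<longleftrightarrow> z \<in> S" if "z \<in> ?W" "S \<subseteq> ?W" for z S
      using that inj_on_image_mem_iff[OF inj, of z S] by auto
    have eqf: "f z = p' \<longleftrightarrow> z = p" "f z = q' \<longleftrightarrow> z = q" if "z \<in> ?W" for z
      using mem[OF that, of "{p}"] mem[OF that, of "{q}"] f by auto
    have "f z \<in> A' \<longleftrightarrow> z \<in> A" "f z \<in> B' \<longleftrightarrow> z \<in> B" if "z \<in> ?W" for z
      using mem[OF that, of A] mem[OF that, of B] im by auto
    then show "(f x = p' \<and> f y \<in> insert q' A' \<or> f x = q' \<and> f y \<in> B') \<longleftrightarrow>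
        (x = p \<and> y \<in> insert q A \<or> x = q \<and> y \<in> B)"
      using eqf xy by simp
  qed
  also have "\<dots> = double_star C' p' q' A' B'"
    using im f by (simp add: double_star_def image_Un)
  finally show ?thesis using inj by auto
qed

text \<open>Without leaves at \<open>q\<close>, the centre \<open>p\<close> is adjacent to
  everything and \<open>q\<close> is just another leaf.\<close>

lemma star_graph_eq_double_star:
  assumes "double_star_data C p q A {}"
  shows "star_graph (insert p C) (insert q A) = double_star C p q A {}"
  using assms by (intro graph_eqI) (auto simp: double_star_def double_star_data_def parcs_cone_iff)

text \<open>Reads the edge exchanges that define \<open>graph_G1\<close> and \<open>graph_G2\<close>
  as passing a leaf from one centre to the other.\<close>

lemma double_star_move_leaf:
  assumes d: "double_star_data C p q (insert x A) B" and x: "x \<notin> A"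
  shows "add_edge x q (delete_edge x p (double_star C p q (insert x A) B)) = double_star C p q A (insert x B)"
proof (rule graph_eqI)
  show "pverts (add_edge x q (delete_edge x p (double_star C p q (insert x A) B)))
      = pverts (double_star C p q A (insert x B))"
    by (auto simp: add_edge_def delete_edge_def)
  have n: "x \<noteq> p" "x \<noteq> q" "p \<noteq> q" "x \<notin> B" "x \<notin> C" "p \<notin> C" "q \<notin> C" "p \<notin> B" "q \<notin> B" "p \<notin> A" "q \<notin> A"
    using d by (auto simp: double_star_data_def)
  fix a b
  have e: "(a, b) \<in> parcs (add_edge x q (delete_edge x p G)) \<longleftrightarrow>
      (a = x \<and> b = q \<or> a = q \<and> b = x) \<or> (a, b) \<in> parcs G \<and> \<not> (a = x \<and> b = p) \<and> \<not> (a = p \<and> b = x)" for G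
    by (auto simp: add_edge_def delete_edge_def)
  show "(a, b) \<in> parcs (add_edge x q (delete_edge x p (double_star C p q (insert x A) B)))
      \<longleftrightarrow> (a, b) \<in> parcs (double_star C p q A (insert x B))"
    unfolding e double_star_def parcs_cone_iff
    by (cases "a = x"; cases "b = x"; simp add: n x; use n x in blast)
qed

section \<open>The graphs of the theorem as stars and double stars\<close>

lemma k_star_eq: "k_star k m = star_graph (V ` {1..k}) (U ` {1..m})"
  by (rule graph_eqI) (auto simp: k_star_def parcs_cone_iff)

text \<open>The vertex \<open>V k\<close> loses only \<open>U 1\<close>, which becomes the single
  leaf of the second centre \<open>U 2\<close>; the other clique vertices stay adjacent to
  everything.\<close>

lemma graph_G1_eq:
  assumes "k \<ge> 1" "n \<ge> k + 2"
  shows "graph_G1 k n = double_star (V ` {1..k - 1}) (V k) (U 2) (U ` {3..n - k}) {U 1}"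
proof -
  have "{1..k} = insert k {1..k - 1}" "{1..n - k} = insert 2 (insert 1 {3..n - k})"
    using assms by auto
  then have "V ` {1..k} = insert (V k) (V ` {1..k - 1})"
    "U ` {1..n - k} = insert (U 2) (insert (U 1) (U ` {3..n - k}))"
    by simp_all
  then have "graph_G1 k n = add_edge (U 1) (U 2) (delete_edge (U 1) (V k)
      (double_star (V ` {1..k - 1}) (V k) (U 2) (insert (U 1) (U ` {3..n - k})) {}))"
    using assms by (subst star_graph_eq_double_star[symmetric]) (auto simp: graph_G1_def k_star_eq double_star_data_def)
  also have "\<dots> = double_star (V ` {1..k - 1}) (V k) (U 2) (U ` {3..n - k}) {U 1}"
    using assms by (intro double_star_move_leaf) (auto simp: double_star_data_def)
  finally show ?thesis .
qed

lemma graph_G2_eq: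
  assumes "k \<ge> 1" "n \<ge> k + 3"
  shows "graph_G2 k n = double_star (V ` {1..k - 1}) (V k) (U 2) (U ` {4..n - k}) {U 1, U 3}"
proof -
  have "{3..n - k} = insert 3 {4..n - k}"
    using assms by auto
  then have "U ` {3..n - k} = insert (U 3) (U ` {4..n - k})"
    by simp
  then have "graph_G2 k n = add_edge (U 3) (U 2) (delete_edge (U 3) (V k)
      (double_star (V ` {1..k - 1}) (V k) (U 2) (insert (U 3) (U ` {4..n - k})) {U 1}))"
    using assms by (simp add: graph_G2_def graph_G1_eq)
  also have "\<dots> = double_star (V ` {1..k - 1}) (V k) (U 2) (U ` {4..n - k}) {U 3, U 1}"
    using assms by (intro double_star_move_leaf) (auto simp: double_star_data_def)
  finally show ?thesis by (simp add: insert_commute)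
qed

section \<open>Redistributing the leaves of a double star\<close>

text \<open>Provides Perron vectors for double stars without identifying them as
  \<open>k\<close>-trees. Every vertex leads to a centre, and the two adjacent centres together see
  all vertices.\<close>

lemma double_star_linked:
  assumes "double_star_data C p q A B"
  shows "linked (double_star C p q A B)"
proof (rule linkedI)
  fix Z assume Z: "Z \<subseteq> pverts (double_star C p q A B)" "Z \<noteq> {}"
    and cl: "\<And>a b. a \<in> Z \<Longrightarrow> (a, b) \<in> parcs (double_star C p q A B) \<Longrightarrow> b \<in> Z"
  note d = assms[unfolded double_star_data_def] and e = double_star_def parcs_cone_iff
  obtain z where z: "z \<in> Z" "z \<in> C \<union> ({p, q} \<union> A \<union> B)" using Z by auto
  have qp: "p \<in> Z" if "q \<in> Z" using cl[OF that, of p] d by (auto simp: e)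
  have "p \<in> Z"
  proof (cases "z \<in> B")
    case True
    then show ?thesis using cl[OF z(1), of q] qp d by (auto simp: e)
  next
    case False
    then show ?thesis using cl[OF z(1), of p] z qp d by (cases "z = q"; cases "z = p") (auto simp: e)
  qed
  moreover from this have "q \<in> Z" using cl[of p q] d by (auto simp: e)
  moreover have "y \<in> C \<union> A \<Longrightarrow> p \<in> Z \<Longrightarrow> y \<in> Z" "y \<in> B \<Longrightarrow> q \<in> Z \<Longrightarrow> y \<in> Z" for y
    using cl[of p y] cl[of q y] d by (auto simp: e)
  ultimately show "pverts (double_star C p q A B) \<subseteq> Z"
    by auto
qed

text \<open>The leaves of each centre are private against the other centre, so the Perron entries at
  the centres decide which transfer increases \<open>q1\<close>.\<close>

lemma double_star_balance:
  assumes d: "double_star_data C p q A B" and A': "A' \<subseteq> A" "A' \<noteq> {}" and B': "B' \<subseteq> B" "B' \<noteq> {}"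
  shows "q1 (double_star C p q A B) < q1 (double_star C p q (A - A') (B \<union> A')) \<or>
    q1 (double_star C p q A B) < q1 (double_star C p q (A \<union> B') (B - B'))"
proof -
  let ?G = "double_star C p q A B"
  note d' = d[unfolded double_star_data_def] and e = double_star_def parcs_cone_iff
  have "move A' p q ?G = double_star C p q (A - A') (B \<union> A')"
    using d' A' by (intro graph_eqI) (auto simp: e parcs_move)
  moreover have "move B' q p ?G = double_star C p q (A \<union> B') (B - B')"
    using d' B' by (intro graph_eqI) (auto simp: e parcs_move)
  moreover have "A' \<subseteq> private_nbhd p q ?G" "B' \<subseteq> private_nbhd q p ?G"
    using d' A' B' by (auto simp: e private_nbhd_def)
  ultimately show ?thesis
    using move_either_increases_q1[OF pair_graph_double_star[OF d] double_star_linked[OF d], of p q A' B']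
      A' B' d' by auto
qed

section \<open>Undoing a shift, and \<open>k\<close>-trees with comparable neighbourhoods\<close>

lemma private_nbhd_shift:
  assumes "pair_graph G" "u \<noteq> v"
  shows "private_nbhd v u (shift u v G) = private_nbhd u v G \<union> private_nbhd v u G"
    and "private_nbhd u v (shift u v G) = {}"
proof -
  have "(u, u) \<notin> parcs G" "(v, v) \<notin> parcs G"
    using assms(1) by (auto simp: pair_graph_iff)
  then show "private_nbhd v u (shift u v G) = private_nbhd u v G \<union> private_nbhd v u G"
    and "private_nbhd u v (shift u v G) = {}"
    using assms(2) by (auto simp: private_nbhd_def parcs_shift_iff[OF assms])
qed

text \<open>A shifted graph shows only the union of the two private neighbourhoods. Once the part of
  \<open>u\<close> is specified, handing it back recovers the original graph.\<close>

lemma move_shift: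
  assumes G: "pair_graph G" and uv: "u \<noteq> v"
  shows "move (private_nbhd u v G) v u (shift u v G) = G"
proof (rule graph_eqI)
  fix a b
  have irr: "(x, x) \<notin> parcs G" and sym: "(x, y) \<in> parcs G \<longleftrightarrow> (y, x) \<in> parcs G" for x y
    using G unfolding pair_graph_iff by blast+
  have M: "x \<in> private_nbhd u v G \<longleftrightarrow> (x, u) \<in> parcs G \<and> (x, v) \<notin> parcs G \<and> x \<noteq> v" for x
    using sym[of u x] sym[of v x] by (simp add: private_nbhd_def)
  show "(a, b) \<in> parcs (move (private_nbhd u v G) v u (shift u v G)) \<longleftrightarrow> (a, b) \<in> parcs G"
    unfolding parcs_move
    by (cases "a = u"; cases "a = v"; cases "b = u"; cases "b = v";
        use uv irr sym[of u b] sym[of v b] in \<open>auto simp: M parcs_shift_iff[OF G uv]\<close>)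
qed simp

text \<open>Induction on the construction. An adjacent pair with incomparable neighbourhoods
  survives a join. A vertex joined to a star either extends the star or creates such a pair.\<close>

lemma k_tree_star_or_private_nbhds:
  "k_tree k G \<Longrightarrow>
    (\<exists>K L. finite K \<and> finite L \<and> K \<inter> L = {} \<and> card K = k \<and> G = star_graph K L) \<or>
    (\<exists>u v. (u, v) \<in> parcs G \<and> private_nbhd u v G \<noteq> {} \<and> private_nbhd v u G \<noteq> {})"
proof (induction rule: k_tree.induct)
  case (complete G)
  then have "G = star_graph (pverts G) {}"
    by (intro graph_eqI) (auto simp: complete_iff parcs_cone_iff)
  moreover have "finite (pverts G)" "card (pverts G) = k" "pverts G \<inter> {} = {}"
    using complete by (simp_all add: complete_iff)
  ultimately show ?case by blast
next
  case (join G C w)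
  let ?J = "join_vertex w C G"
  have wf: "x \<in> pverts G" "y \<in> pverts G" if "(x, y) \<in> parcs G" for x y
    using that k_tree_pair_graph[OF join(1)] by (auto simp: pair_graph_iff)
  from join.IH show ?case
  proof
    assume "\<exists>u v. (u, v) \<in> parcs G \<and> private_nbhd u v G \<noteq> {} \<and> private_nbhd v u G \<noteq> {}"
    then obtain u v where uv: "(u, v) \<in> parcs G" "private_nbhd u v G \<noteq> {}" "private_nbhd v u G \<noteq> {}"
      by blast
    then have "u \<noteq> w" "v \<noteq> w" using wf join(4) by blast+
    then have "private_nbhd u v G \<subseteq> private_nbhd u v ?J" "private_nbhd v u G \<subseteq> private_nbhd v u ?J"
      using wf join(4) by (auto simp: private_nbhd_def parcs_join_vertex_iff)
    moreover have "(u, v) \<in> parcs ?J" using uv by (simp add: parcs_join_vertex_iff)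
    ultimately have "(u, v) \<in> parcs ?J \<and> private_nbhd u v ?J \<noteq> {} \<and> private_nbhd v u ?J \<noteq> {}"
      using uv by auto
    then show ?thesis by blast
  next
    assume "\<exists>K L. finite K \<and> finite L \<and> K \<inter> L = {} \<and> card K = k \<and> G = star_graph K L"
    then obtain K L where KL: "finite K" "finite L" "K \<inter> L = {}" "card K = k" and G: "G = star_graph K L"
      by blast
    have wKL: "w \<notin> K" "w \<notin> L" using join(4) G by auto
    have C: "C \<subseteq> K \<union> L" and Cadj: "\<And>x y. x \<in> C \<Longrightarrow> y \<in> C \<Longrightarrow> x \<noteq> y \<Longrightarrow> x \<in> K \<or> y \<in> K"
      using join(2) G by (auto simp: clique_def parcs_cone_iff)
    show ?thesis
    proof (cases "C \<subseteq> K")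
      case True
      then have "C = K" using card_subset_eq[OF KL(1)] KL(4) join(3) by simp
      then have "?J = star_graph K (insert w L)"
        unfolding G using wKL by (intro graph_eqI) (auto simp: parcs_join_vertex_iff parcs_cone_iff)
      then show ?thesis using KL wKL by (intro disjI1 exI[of _ K] exI[of _ "insert w L"]) auto
    next
      case False
      then obtain l where l: "l \<in> C" "l \<in> L" using C by auto
      \<comment> \<open>Leaves are pairwise nonadjacent, so the clique \<open>C\<close> contains no
        leaf besides \<open>l\<close>.\<close>
      have CK: "C - {l} \<subseteq> K" using C Cadj l KL(3) by blast
      have finC: "finite C" using C KL finite_subset by blast
      have "card (C - {l}) < card K" using l finC join(3) KL(4) card_Diff1_less by metis
      then have "C - {l} \<noteq> K" by auto
      then obtain c where c: "c \<in> K" "c \<notin> C" using CK l KL(3) by blast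
      have "c \<noteq> l" using c l by auto
      show ?thesis
      proof (cases "L = {l}")
        case True
        \<comment> \<open>With \<open>l\<close> as the only leaf the old graph is complete, so
          \<open>C\<close> can replace \<open>K\<close> as the core, with leaves \<open>c\<close>
          and \<open>w\<close>.\<close>
        have "card (K - {c}) = card (C - {l})"
          using c l KL join(3) finC by simp
        moreover have "C - {l} \<subseteq> K - {c}" using CK c by auto
        ultimately have "C - {l} = K - {c}" using card_subset_eq[of "K - {c}"] KL(1) by simp
        then have K: "K = insert c (C - {l})" using c by auto
        have "?J = star_graph C {c, w}"
          unfolding G True K using l c wKL KL(3) True K
          by (intro graph_eqI) (auto simp: parcs_join_vertex_iff parcs_cone_iff)
        moreover have "C \<inter> {c, w} = {}" using c wKL C by auto
        ultimately show ?thesis using finC join(3) by (intro disjI1 exI[of _ C] exI[of _ "{c, w}"]) auto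
      next
        case False
        then obtain l' where l': "l' \<in> L" "l' \<noteq> l" using l by auto
        \<comment> \<open>The core vertex \<open>c\<close> sees the other leaf \<open>l'\<close> but
          not \<open>w\<close>, while \<open>l\<close> sees \<open>w\<close> but not
          \<open>l'\<close>.\<close>
        have "(c, l) \<in> parcs ?J" using c l \<open>c \<noteq> l\<close> by (auto simp: G parcs_join_vertex_iff parcs_cone_iff)
        moreover have "l' \<in> private_nbhd c l ?J"
          using c l l' KL(3) wKL by (auto simp: private_nbhd_def G parcs_join_vertex_iff parcs_cone_iff)
        moreover have "w \<in> private_nbhd l c ?J"
          using c l wKL by (auto simp: private_nbhd_def G parcs_join_vertex_iff parcs_cone_iff)
        ultimately show ?thesis by blast
      qed
    qed
  qed
qed

section \<open>Comparing double stars with \<open>graph_G2\<close>\<close>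

lemma digraph_iso_q1:
  assumes "pair_graph G" "pverts G \<noteq> {}" "digraph_iso (with_proj G) (with_proj H)"
  shows "q1 H = q1 G"
  using assms q1_map_graph by (auto simp: digraph_iso_iff)

lemma double_star_iso_G2:
  assumes d: "double_star_data C p q A B" and k: "k \<ge> 1" "card C = k - 1"
    and n: "card (pverts (double_star C p q A B)) = n" and AB: "A \<noteq> {}" "card B = 2"
  shows "digraph_iso (with_proj (double_star C p q A B)) (with_proj (graph_G2 k n))"
proof -
  have "card A > 0" using d AB by (simp add: double_star_data_def card_gt_0_iff)
  \<comment> \<open>The vertex count is \<open>(k - 1) + 2 + card A + 2\<close>.\<close>
  then have nk: "n \<ge> k + 3" "card A = n - k - 3" using n card_double_star[OF d] k AB by simp_all
  have inj: "inj V" "inj U" by (auto simp: inj_def)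
  have "\<exists>f. inj_on f (pverts (double_star C p q A B)) \<and> graph_G2 k n = map_graph f (double_star C p q A B)"
    unfolding graph_G2_eq[OF k(1) nk(1)]
  proof (rule double_star_iso[OF d])
    show "card C = card (V ` {1..k - 1})" "card A = card (U ` {4..n - k})" "card B = card {U 1, U 3}"
      using k nk AB inj by (simp_all add: card_image inj_on_subset)
  qed (auto simp: double_star_data_def)
  then show ?thesis using pair_graph_double_star[OF d] by (simp add: digraph_iso_iff)
qed

text \<open>A double star with two leaves at one centre and some at the other is
  \<open>graph_G2\<close> itself. If both centres have at least three leaves, removing all but two
  from either side yields \<open>graph_G2\<close>, and one of these transfers increases
  \<open>q1\<close>. Three leaves in total means \<open>n = k + 4\<close>.\<close>

lemma double_star_iso_or_less:
  assumes d: "double_star_data C p q A B" and k: "k \<ge> 1" "card C = k - 1"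
    and n: "card (pverts (double_star C p q A B)) = n"
    and AB: "card A \<ge> 2 \<and> card B \<ge> 2 \<or> A \<noteq> {} \<and> B \<noteq> {} \<and> card A + card B = 3"
  shows "digraph_iso (with_proj (double_star C p q A B)) (with_proj (graph_G2 k n)) \<or>
    q1 (double_star C p q A B) < q1 (graph_G2 k n)"
proof -
  let ?G = "double_star C p q A B"
  have fin: "finite A" "finite B" using d by (auto simp: double_star_data_def)
  have ne: "A \<noteq> {}" "B \<noteq> {}" using AB by auto
  then have pos: "card A > 0" "card B > 0" using fin by (simp_all add: card_gt_0_iff)
  then consider "card B = 2" | "card A = 2" | "card A > 2" "card B > 2"
    using AB by linarith
  then show ?thesis
  proof cases
    case 1
    then show ?thesis using double_star_iso_G2[OF d k n ne(1)] by simp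
  next
    case 2
    then show ?thesis
      using double_star_iso_G2[OF double_star_data_commute[OF d] k _ ne(2)] n
      by (simp add: double_star_commute[of C q p])
  next
    case 3
    \<comment> \<open>Both transfers are chosen to end with exactly two leaves at the giving centre,
      so the two possible results are isomorphic.\<close>
    obtain A' where A': "A' \<subseteq> A" "card A' = card A - 2"
      by (meson diff_le_self obtain_subset_with_card_n)
    obtain B' where B': "B' \<subseteq> B" "card B' = card B - 2"
      by (meson diff_le_self obtain_subset_with_card_n)
    have ne': "A' \<noteq> {}" "B' \<noteq> {}" using 3 A' B' by auto
    have c: "card (A - A') = 2" "card (B - B') = 2"
      using A' B' 3 fin by (simp_all add: card_Diff_subset finite_subset)
    have dA: "double_star_data C q p (B \<union> A') (A - A')" and dB: "double_star_data C p q (A \<union> B') (B - B')"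
      using d A' B' by (auto simp: double_star_data_def intro: finite_subset)
    have P: "pverts (double_star C q p (B \<union> A') (A - A')) = pverts ?G"
      "pverts (double_star C p q (A \<union> B') (B - B')) = pverts ?G"
      using A' B' by auto
    have "q1 (graph_G2 k n) = q1 (double_star C q p (B \<union> A') (A - A'))"
      using double_star_iso_G2[OF dA k _ _ c(1)] n ne' P(1) by (intro digraph_iso_q1 pair_graph_double_star[OF dA]) auto
    moreover have "q1 (graph_G2 k n) = q1 (double_star C p q (A \<union> B') (B - B'))"
      using double_star_iso_G2[OF dB k _ _ c(2)] n ne' P(2) by (intro digraph_iso_q1 pair_graph_double_star[OF dB]) auto
    ultimately show ?thesis
      using double_star_balance[OF d A'(1) ne'(1) B'(1) ne'(2)] by (simp add: double_star_commute[of C p q "A - A'"])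
  qed
qed

lemma less_double_star_less:
  assumes "double_star_data C p q A B" "k \<ge> 1" "card C = k - 1"
    and "card (pverts (double_star C p q A B)) = n"
    and "card A \<ge> 2 \<and> card B \<ge> 2 \<or> A \<noteq> {} \<and> B \<noteq> {} \<and> card A + card B = 3"
    and "q1 G < q1 (double_star C p q A B)"
  shows "q1 G < q1 (graph_G2 k n)"
  using double_star_iso_or_less[OF assms(1-5)] assms(6)
    digraph_iso_q1[OF pair_graph_double_star[OF assms(1)], of "graph_G2 k n"] by fastforce

section \<open>The preimages of the star and of \<open>G\<^sub>1\<close> under a shift\<close>

lemma parcs_move_iff:
  "(a, b) \<in> parcs (move M u v G) \<longleftrightarrow>
    (a, b) \<in> parcs G \<and> \<not> (a = u \<and> b \<in> M) \<and> \<not> (a \<in> M \<and> b = u) \<or> a = v \<and> b \<in> M \<or> a \<in> M \<and> b = v"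
  by (auto simp: parcs_move)

text \<open>
  \<open>G\<close> is the join of \<open>C\<close> with a triangle \<open>c p q\<close> to whose edges \<open>c p\<close>, \<open>p q\<close> and \<open>c q\<close> the
  vertices in \<open>A1\<close>, in \<open>A2\<close> and \<open>w\<close> are attached. Moving \<open>w\<close> to either of the other two edges
  makes \<open>p\<close> dominating.
\<close>

lemma q1_less_triangle:
  assumes d: "double_star_data (insert c C) p q (A1 \<union> A2) {w}" and c: "c \<notin> C"
    and k: "k \<ge> 1" "card (insert c C) = k - 1"
    and n: "card (pverts (double_star (insert c C) p q (A1 \<union> A2) {w})) = n"
    and A: "A1 \<inter> A2 = {}" "A1 \<noteq> {}" "A2 \<noteq> {}"
    and G: "G = move A2 c q (double_star (insert c C) p q (A1 \<union> A2) {w})" "pair_graph G" "linked G"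
  shows "q1 G < q1 (graph_G2 k n)"
proof -
  let ?C = "insert p C"
  note e = double_star_def parcs_cone_iff parcs_move_iff
  have ne: "c \<noteq> p" "c \<noteq> q" "c \<noteq> w" "p \<noteq> q" "p \<noteq> w" "q \<noteq> w" "c \<notin> C" "p \<notin> C" "q \<notin> C" "w \<notin> C"
    "c \<notin> A1" "p \<notin> A1" "q \<notin> A1" "w \<notin> A1" "c \<notin> A2" "p \<notin> A2" "q \<notin> A2" "w \<notin> A2"
    and dj: "\<And>x. x \<in> C \<Longrightarrow> x \<notin> A1" "\<And>x. x \<in> C \<Longrightarrow> x \<notin> A2" "\<And>x. x \<in> A1 \<Longrightarrow> x \<notin> A2"
    using d c A(1) by (auto simp: double_star_data_def)
  \<comment> \<open>The possible positions of a vertex, stated so that each adjacency becomes a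
    finite case check.\<close>
  have cl: "x \<in> {c, p, q, w} \<or> x \<notin> {c, p, q, w} \<and> (x \<in> C \<and> x \<notin> A1 \<and> x \<notin> A2 \<or>
      x \<notin> C \<and> x \<in> A1 \<and> x \<notin> A2 \<or> x \<notin> C \<and> x \<notin> A1 \<and> x \<in> A2 \<or> x \<notin> C \<and> x \<notin> A1 \<and> x \<notin> A2)" for x
    using dj by blast
  have priv: "private_nbhd c p G = {w}" "private_nbhd p c G = A2"
    "private_nbhd q p G = {w}" "private_nbhd p q G = A1"
    using ne dj unfolding G(1) private_nbhd_def e by auto
  have P: "pverts (double_star ?C q c (insert w A2) A1) = pverts G"
     "pverts (double_star ?C c q (insert w A1) A2) = pverts G"
    unfolding G(1) by auto
  have s1: "shift c p G = double_star ?C q c (insert w A2) A1"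
  proof (rule graph_eqI)
    fix a b
    show "(a, b) \<in> parcs (shift c p G) \<longleftrightarrow> (a, b) \<in> parcs (double_star ?C q c (insert w A2) A1)"
      unfolding shift_def priv unfolding G(1) e
      by (cases "a \<in> {c, p, q, w}"; cases "b \<in> {c, p, q, w}"; use cl[of a] cl[of b] ne in auto)
  qed (simp only: P pverts_shift)
  have s2: "shift q p G = double_star ?C c q (insert w A1) A2"
  proof (rule graph_eqI)
    fix a b
    show "(a, b) \<in> parcs (shift q p G) \<longleftrightarrow> (a, b) \<in> parcs (double_star ?C c q (insert w A1) A2)"
      unfolding shift_def priv unfolding G(1) e
      by (cases "a \<in> {c, p, q, w}"; cases "b \<in> {c, p, q, w}"; use cl[of a] cl[of b] ne in auto)
  qed (simp only: P pverts_shift)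
  have mem: "c \<in> pverts G" "p \<in> pverts G" "q \<in> pverts G" "c \<noteq> p" "q \<noteq> p"
    using ne by (auto simp: G(1))
  have less: "q1 G < q1 (double_star ?C q c (insert w A2) A1)"
    "q1 G < q1 (double_star ?C c q (insert w A1) A2)"
    using shift_increases_q1[OF G(2,3) mem(1,2,4)] shift_increases_q1[OF G(2,3) mem(3,2,5)] A
    unfolding priv s1 s2 by auto
  have fin: "finite C" "finite A1" "finite A2" using d by (auto simp: double_star_data_def)
  have d1: "double_star_data ?C q c (insert w A2) A1" and d2: "double_star_data ?C c q (insert w A1) A2"
    unfolding double_star_data_def using fin ne dj by auto
  have C: "card ?C = k - 1" using k c fin ne by simp
  have nG: "card (pverts G) = n" using n by (simp add: G(1))
  have card: "card (insert w A1) = Suc (card A1)" "card (insert w A2) = Suc (card A2)"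
    "card A1 > 0" "card A2 > 0" using A fin ne by (simp_all add: card_gt_0_iff)
  \<comment> \<open>The two shifts leave \<open>card A2 + 1\<close> against \<open>card A1\<close>
    leaves and \<open>card A1 + 1\<close> against \<open>card A2\<close> leaves. The first suffices
    when \<open>card A1\<close> is at least 2, the second when it is 1.\<close>
  show ?thesis
  proof (cases "card A1 \<ge> 2")
    case True
    then have "card (insert w A2) \<ge> 2 \<and> card A1 \<ge> 2" using card by simp
    then show ?thesis
      using less_double_star_less[OF d1 k(1) C _ _ less(1)] nG unfolding P by blast
  next
    case False
    then have "card A1 = 1" using card by simp
    then have "card (insert w A1) \<ge> 2 \<and> card A2 \<ge> 2 \<or>
        insert w A1 \<noteq> {} \<and> A2 \<noteq> {} \<and> card (insert w A1) + card A2 = 3"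
      using card A by auto
    then show ?thesis
      using less_double_star_less[OF d2 k(1) C _ _ less(2)] nG unfolding P by blast
  qed
qed

text \<open>
  \<open>G\<close> is the join of \<open>C\<close> with a tree, the path \<open>a p q\<close> with leaves \<open>A2\<close>, \<open>A1\<close> and \<open>w\<close> attached.
  The first shift is along the nonadjacent pair \<open>q\<close>, \<open>a\<close>, so it need not produce a \<open>k\<close>-tree
  a priori.
\<close>

lemma q1_less_caterpillar:
  assumes d: "double_star_data C p q (insert a (A1 \<union> A2)) {w}" and a: "a \<notin> A1 \<union> A2"
    and k: "k \<ge> 1" "card C = k - 1"
    and n: "card (pverts (double_star C p q (insert a (A1 \<union> A2)) {w})) = n"
    and A: "A1 \<inter> A2 = {}" "A2 \<noteq> {}"
    and G: "G = move A2 p a (double_star C p q (insert a (A1 \<union> A2)) {w})" "pair_graph G" "linked G"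
  shows "q1 G < q1 (graph_G2 k n)"
proof -
  note e = double_star_def parcs_cone_iff parcs_move_iff
  have ne: "a \<noteq> p" "a \<noteq> q" "a \<noteq> w" "p \<noteq> q" "p \<noteq> w" "q \<noteq> w" "a \<notin> C" "p \<notin> C" "q \<notin> C" "w \<notin> C"
    "a \<notin> A1" "p \<notin> A1" "q \<notin> A1" "w \<notin> A1" "a \<notin> A2" "p \<notin> A2" "q \<notin> A2" "w \<notin> A2"
    and dj: "\<And>x. x \<in> C \<Longrightarrow> x \<notin> A1" "\<And>x. x \<in> C \<Longrightarrow> x \<notin> A2" "\<And>x. x \<in> A1 \<Longrightarrow> x \<notin> A2"
    using d a A(1) by (auto simp: double_star_data_def)
  have cl: "x \<in> {a, p, q, w} \<or> x \<notin> {a, p, q, w} \<and> (x \<in> C \<and> x \<notin> A1 \<and> x \<notin> A2 \<or>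
      x \<notin> C \<and> x \<in> A1 \<and> x \<notin> A2 \<or> x \<notin> C \<and> x \<notin> A1 \<and> x \<in> A2 \<or> x \<notin> C \<and> x \<notin> A1 \<and> x \<notin> A2)" for x
    using dj by blast
  have priv: "private_nbhd q a G = {w}" "private_nbhd a q G = A2"
    "private_nbhd q p G = {w}" "private_nbhd p q G = insert a A1"
    using ne dj unfolding G(1) private_nbhd_def e by auto
  have P: "pverts (double_star C p a (insert q A1) (insert w A2)) = pverts G"
     "pverts (double_star C p a (insert q (insert w A1)) A2) = pverts G"
    unfolding G(1) by auto
  have s1: "shift q a G = double_star C p a (insert q A1) (insert w A2)"
  proof (rule graph_eqI)
    fix x y
    show "(x, y) \<in> parcs (shift q a G) \<longleftrightarrow> (x, y) \<in> parcs (double_star C p a (insert q A1) (insert w A2))"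
      unfolding shift_def priv unfolding G(1) e
      by (cases "x \<in> {a, p, q, w}"; cases "y \<in> {a, p, q, w}"; use cl[of x] cl[of y] ne in auto)
  qed (simp only: P pverts_shift)
  have s2: "shift q p G = double_star C p a (insert q (insert w A1)) A2"
  proof (rule graph_eqI)
    fix x y
    show "(x, y) \<in> parcs (shift q p G) \<longleftrightarrow> (x, y) \<in> parcs (double_star C p a (insert q (insert w A1)) A2)"
      unfolding shift_def priv unfolding G(1) e
      by (cases "x \<in> {a, p, q, w}"; cases "y \<in> {a, p, q, w}"; use cl[of x] cl[of y] ne in auto)
  qed (simp only: P pverts_shift)
  have mem: "a \<in> pverts G" "p \<in> pverts G" "q \<in> pverts G" "q \<noteq> a" "q \<noteq> p"
    using ne by (auto simp: G(1))
  have less: "q1 G < q1 (double_star C p a (insert q A1) (insert w A2))"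
    "q1 G < q1 (double_star C p a (insert q (insert w A1)) A2)"
    using shift_increases_q1[OF G(2,3) mem(3,1,4)] shift_increases_q1[OF G(2,3) mem(3,2,5)] A
    unfolding priv s1 s2 by auto
  have fin: "finite C" "finite A1" "finite A2" using d by (auto simp: double_star_data_def)
  have d1: "double_star_data C p a (insert q A1) (insert w A2)"
    and d2: "double_star_data C p a (insert q (insert w A1)) A2"
    unfolding double_star_data_def using fin ne dj by auto
  have nG: "card (pverts G) = n" using n by (simp add: G(1))
  have card: "card (insert q A1) = Suc (card A1)" "card (insert w A2) = Suc (card A2)"
    "card (insert q (insert w A1)) = Suc (Suc (card A1))" "card A2 > 0"
    using A fin ne by (simp_all add: card_gt_0_iff)
  \<comment> \<open>The leaf numbers are \<open>card A1 + 1\<close> and \<open>card A2 + 1\<close>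
    after one shift, \<open>card A1 + 2\<close> and \<open>card A2\<close> after the other. The
    second is used when \<open>A1\<close> is empty and \<open>A2\<close> has at least two
    elements.\<close>
  show ?thesis
  proof (cases "card A1 \<ge> 1 \<or> card A2 = 1")
    case True
    then have "card (insert q A1) \<ge> 2 \<and> card (insert w A2) \<ge> 2 \<or>
        insert q A1 \<noteq> {} \<and> insert w A2 \<noteq> {} \<and> card (insert q A1) + card (insert w A2) = 3"
      using card by auto
    then show ?thesis
      using less_double_star_less[OF d1 k _ _ less(1)] nG unfolding P by blast
  next
    case False
    then have "card (insert q (insert w A1)) \<ge> 2 \<and> card A2 \<ge> 2" using card by linarith
    then show ?thesis
      using less_double_star_less[OF d2 k _ _ less(2)] nG unfolding P by blast
  qed
qed

text \<open>
  \<open>G\<close> is the join of \<open>C\<close> with two triangles \<open>c p a\<close> and \<open>c p q\<close> (and \<open>A1\<close> attached to \<open>c p\<close>), with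
  \<open>A2\<close> attached to \<open>a p\<close> and \<open>w\<close> attached to \<open>c q\<close>.
\<close>

lemma q1_less_triangle_pair:
  assumes d: "double_star_data (insert c C) p q (insert a (A1 \<union> A2)) {w}" and ca: "c \<notin> C" "a \<notin> A1 \<union> A2"
    and k: "k \<ge> 1" "card (insert c C) = k - 1"
    and n: "card (pverts (double_star (insert c C) p q (insert a (A1 \<union> A2)) {w})) = n"
    and A: "A1 \<inter> A2 = {}" "A2 \<noteq> {}"
    and G: "G = move A2 c a (double_star (insert c C) p q (insert a (A1 \<union> A2)) {w})" "k_tree k G"
  shows "q1 G < q1 (graph_G2 k n)"
proof -
  note e = double_star_def parcs_cone_iff parcs_move_iff
  have pG: "pair_graph G" and lG: "linked G"
    using k_tree_pair_graph[OF G(2)] k_tree_linked[OF k(1) G(2)] .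
  have ne: "a \<noteq> c" "c \<noteq> p" "c \<noteq> q" "c \<noteq> w" "c \<notin> C" "c \<notin> A1" "c \<notin> A2"
    "a \<noteq> p" "a \<noteq> q" "a \<noteq> w" "p \<noteq> q" "p \<noteq> w" "q \<noteq> w" "a \<notin> C" "p \<notin> C" "q \<notin> C" "w \<notin> C"
    "a \<notin> A1" "p \<notin> A1" "q \<notin> A1" "w \<notin> A1" "a \<notin> A2" "p \<notin> A2" "q \<notin> A2" "w \<notin> A2"
    and dj: "\<And>x. x \<in> C \<Longrightarrow> x \<notin> A1" "\<And>x. x \<in> C \<Longrightarrow> x \<notin> A2" "\<And>x. x \<in> A1 \<Longrightarrow> x \<notin> A2"
    using d ca A(1) by (auto simp: double_star_data_def)
  have priv: "private_nbhd p c G = A2" "private_nbhd c p G = {w}"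
    using ne dj unfolding G(1) private_nbhd_def e by auto
  \<comment> \<open>Passing \<open>A2\<close> from \<open>p\<close> to \<open>c\<close> makes
    \<open>c\<close> adjacent to everything and leaves the path through \<open>a\<close>,
    \<open>p\<close>, \<open>q\<close> with its leaves. As \<open>p\<close> and \<open>c\<close> are
    adjacent, this caterpillar is still a \<open>k\<close>-tree.\<close>
  have s: "shift p c G = move A2 p a (double_star (insert c C) p q (insert a (A1 \<union> A2)) {w})"
  proof (rule graph_eqI)
    fix x y
    have "z \<in> A2 \<Longrightarrow> z \<noteq> a \<and> z \<noteq> c \<and> z \<noteq> p \<and> z \<noteq> q \<and> z \<noteq> w \<and> z \<notin> C \<and> z \<notin> A1" for z
      using ne dj by blast
    then show "(x, y) \<in> parcs (shift p c G) \<longleftrightarrow>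
        (x, y) \<in> parcs (move A2 p a (double_star (insert c C) p q (insert a (A1 \<union> A2)) {w}))"
      unfolding shift_def priv unfolding G(1) e
      using ne by (cases "x \<in> A2"; cases "y \<in> A2") auto
  qed (simp add: G(1))
  have mem: "p \<in> pverts G" "c \<in> pverts G" "p \<noteq> c" "(p, c) \<in> parcs G"
    using ne unfolding G(1) e by auto
  have kt: "k_tree k (shift p c G)" using k_tree_shift[OF G(2) mem(4)] .
  have "q1 G < q1 (shift p c G)"
    using shift_increases_q1[OF pG lG mem(1-3)] priv A by simp
  also have "\<dots> < q1 (graph_G2 k n)"
    using q1_less_caterpillar[OF d ca(2) k n A s k_tree_pair_graph[OF kt] k_tree_linked[OF k(1) kt]] .
  finally show ?thesis .
qed

section \<open>Graphs that a shift maps to a star\<close>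

text \<open>The shift made \<open>u\<close> a leaf and \<open>v\<close> a core vertex. Undoing it
  splits the other leaves between the two, which become the centres of a double star.\<close>

lemma shift_eq_star_graph:
  assumes G: "pair_graph G" and uv: "(u, v) \<in> parcs G"
    and ne: "private_nbhd u v G \<noteq> {}" "private_nbhd v u G \<noteq> {}"
    and H: "shift u v G = star_graph K S" "finite K" "finite S" "K \<inter> S = {}"
  obtains C p q A B where "double_star_data C p q A B" "card C = card K - 1" "A \<noteq> {}" "B \<noteq> {}"
    "G = double_star C p q A B"
proof -
  let ?M = "private_nbhd u v G" and ?L = "private_nbhd v u G"
  have nuv: "u \<noteq> v" using G uv by (auto simp: pair_graph_iff)
  have priv: "private_nbhd v u (star_graph K S) = ?M \<union> ?L" "?M \<inter> ?L = {}"
    using private_nbhd_shift(1)[OF G nuv] H by (auto simp: private_nbhd_def)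
  have "(u, v) \<in> parcs (star_graph K S)"
    using uv nuv parcs_shift_iff[OF G nuv, of u v] H(1) by simp
  moreover have in_v: "x \<in> ?M \<union> ?L \<longleftrightarrow> (v, x) \<in> parcs (star_graph K S) \<and> (u, x) \<notin> parcs (star_graph K S) \<and> x \<noteq> u" for x
    unfolding priv(1)[symmetric] by (simp add: private_nbhd_def)
  obtain m where "m \<in> ?M \<union> ?L" using ne by blast
  \<comment> \<open>After the shift \<open>v\<close> has a neighbour that \<open>u\<close> lacks, so
    \<open>u\<close> is not in the core; being adjacent to the leaf \<open>u\<close>,
    \<open>v\<close> is.\<close>
  ultimately have mem: "u \<in> S" "v \<in> K"
    using in_v[of m] H(4) unfolding parcs_cone_iff by blast+
  then have "x \<in> ?M \<union> ?L \<longleftrightarrow> x \<in> S - {u}" for x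
    unfolding in_v parcs_cone_iff using H(4) by auto
  then have S: "?M \<union> ?L = S - {u}" by blast
  have d: "double_star_data (K - {v}) v u ?L ?M"
    unfolding double_star_data_def
    using mem S priv(2) H finite_subset[of ?M "S - {u}"] finite_subset[of ?L "S - {u}"] nuv by blast
  have "move ?M v u (star_graph K S) = double_star (K - {v}) v u ?L ?M"
  proof (rule graph_eqI)
    show "pverts (move ?M v u (star_graph K S)) = pverts (double_star (K - {v}) v u ?L ?M)"
      using mem S by auto
    fix x y
    have cl: "x \<in> {u, v} \<or> x \<notin> {u, v} \<and> (x \<in> K \<and> x \<notin> S \<and> x \<notin> ?M \<and> x \<notin> ?L \<or>
      x \<notin> K \<and> x \<in> S \<and> x \<in> ?M \<and> x \<notin> ?L \<or> x \<notin> K \<and> x \<in> S \<and> x \<notin> ?M \<and> x \<in> ?L \<or>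
      x \<notin> K \<and> x \<notin> S \<and> x \<notin> ?M \<and> x \<notin> ?L)" for x
      using mem S priv(2) H(4) by blast
    have n: "u \<notin> K" "v \<notin> S" "u \<notin> ?M" "v \<notin> ?M" "u \<notin> ?L" "v \<notin> ?L"
      using mem S H(4) by blast+
    show "(x, y) \<in> parcs (move ?M v u (star_graph K S)) \<longleftrightarrow> (x, y) \<in> parcs (double_star (K - {v}) v u ?L ?M)"
      unfolding parcs_move_iff double_star_def parcs_cone_iff
      by (cases "x \<in> {u, v}"; cases "y \<in> {u, v}"; use cl[of x] cl[of y] n mem nuv in auto)
  qed
  then have "G = double_star (K - {v}) v u ?L ?M"
    using move_shift[OF G nuv] H(1) by simp
  then show ?thesis using that[OF d _ ne(2,1)] mem by simp
qed

section \<open>Graphs that a shift maps to a double star with one leaf at a centre\<close>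

lemma double_star_data_swap:
  assumes "a \<notin> A1 \<union> A2"
  shows "c \<notin> C \<Longrightarrow> double_star_data (insert c C) p q (insert a (A1 \<union> A2)) {w} \<Longrightarrow>
      double_star_data (insert a C) p q (insert c (A2 \<union> A1)) {w}"
    and "double_star_data C p q (insert a (A1 \<union> A2)) {w} \<Longrightarrow>
      double_star_data C a q (insert p (A2 \<union> A1)) {w}"
  using assms by (auto simp: double_star_data_def)

text \<open>
  If the connected piece \<open>{q, w}\<close> changes sides in a shift, exchanging the two shifted vertices
  brings it back.
\<close>

lemma triangle_pair_swap:
  assumes d: "double_star_data (insert c C) p q (insert a (A1 \<union> A2)) {w}" and ca: "c \<notin> C" "a \<notin> A1 \<union> A2"
    and A: "A1 \<inter> A2 = {}"
  shows "move (A2 \<union> {q, w}) c a (double_star (insert c C) p q (insert a (A1 \<union> A2)) {w}) =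
    move A1 a c (double_star (insert a C) p q (insert c (A2 \<union> A1)) {w})"
proof (rule graph_eqI)
  fix x y
  have ne: "a \<noteq> c" "c \<noteq> p" "c \<noteq> q" "c \<noteq> w" "c \<notin> C" "c \<notin> A1" "c \<notin> A2"
    "a \<noteq> p" "a \<noteq> q" "a \<noteq> w" "p \<noteq> q" "p \<noteq> w" "q \<noteq> w" "a \<notin> C" "p \<notin> C" "q \<notin> C" "w \<notin> C"
    "a \<notin> A1" "p \<notin> A1" "q \<notin> A1" "w \<notin> A1" "a \<notin> A2" "p \<notin> A2" "q \<notin> A2" "w \<notin> A2"
    and dj: "\<And>x. x \<in> C \<Longrightarrow> x \<notin> A1" "\<And>x. x \<in> C \<Longrightarrow> x \<notin> A2" "\<And>x. x \<in> A1 \<Longrightarrow> x \<notin> A2"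
    using d ca A by (auto simp: double_star_data_def)
  have cl: "x \<in> {a, c, p, q, w} \<or> x \<notin> {a, c, p, q, w} \<and> (x \<in> C \<and> x \<notin> A1 \<and> x \<notin> A2 \<or>
      x \<notin> C \<and> x \<in> A1 \<and> x \<notin> A2 \<or> x \<notin> C \<and> x \<notin> A1 \<and> x \<in> A2 \<or> x \<notin> C \<and> x \<notin> A1 \<and> x \<notin> A2)" for x
    using dj by blast
  show "(x, y) \<in> parcs (move (A2 \<union> {q, w}) c a (double_star (insert c C) p q (insert a (A1 \<union> A2)) {w})) \<longleftrightarrow>
      (x, y) \<in> parcs (move A1 a c (double_star (insert a C) p q (insert c (A2 \<union> A1)) {w}))"
    unfolding parcs_move_iff double_star_def parcs_cone_iff
    by (cases "x \<in> {a, c, p, q, w}"; cases "y \<in> {a, c, p, q, w}"; use cl[of x] cl[of y] ne in auto)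
qed auto

text \<open>Here only \<open>q\<close> is moved, since \<open>w\<close> is not adjacent to
  \<open>p\<close>; exchanging \<open>p\<close> and \<open>a\<close> returns it together with its
  leaf.\<close>

lemma caterpillar_swap:
  assumes d: "double_star_data C p q (insert a (A1 \<union> A2)) {w}" and a: "a \<notin> A1 \<union> A2"
    and A: "A1 \<inter> A2 = {}"
  shows "move (insert q A2) p a (double_star C p q (insert a (A1 \<union> A2)) {w}) =
    move A1 a p (double_star C a q (insert p (A2 \<union> A1)) {w})"
proof (rule graph_eqI)
  fix x y
  have ne: "a \<noteq> p" "a \<noteq> q" "a \<noteq> w" "p \<noteq> q" "p \<noteq> w" "q \<noteq> w" "a \<notin> C" "p \<notin> C" "q \<notin> C" "w \<notin> C"
    "a \<notin> A1" "p \<notin> A1" "q \<notin> A1" "w \<notin> A1" "a \<notin> A2" "p \<notin> A2" "q \<notin> A2" "w \<notin> A2"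
    and dj: "\<And>x. x \<in> C \<Longrightarrow> x \<notin> A1" "\<And>x. x \<in> C \<Longrightarrow> x \<notin> A2" "\<And>x. x \<in> A1 \<Longrightarrow> x \<notin> A2"
    using d a A by (auto simp: double_star_data_def)
  have cl: "x \<in> {a, p, q, w} \<or> x \<notin> {a, p, q, w} \<and> (x \<in> C \<and> x \<notin> A1 \<and> x \<notin> A2 \<or>
      x \<notin> C \<and> x \<in> A1 \<and> x \<notin> A2 \<or> x \<notin> C \<and> x \<notin> A1 \<and> x \<in> A2 \<or> x \<notin> C \<and> x \<notin> A1 \<and> x \<notin> A2)" for x
    using dj by blast
  show "(x, y) \<in> parcs (move (insert q A2) p a (double_star C p q (insert a (A1 \<union> A2)) {w})) \<longleftrightarrow>
      (x, y) \<in> parcs (move A1 a p (double_star C a q (insert p (A2 \<union> A1)) {w}))"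
    unfolding parcs_move_iff double_star_def parcs_cone_iff
    by (cases "x \<in> {a, p, q, w}"; cases "y \<in> {a, p, q, w}"; use cl[of x] cl[of y] ne in auto)
qed auto

text \<open>\<open>G\<close> is recovered from \<open>H\<close> by moving \<open>M\<close> back to
  \<open>u\<close>, so the positions of \<open>u\<close> and \<open>v\<close> in \<open>H\<close>
  and the splitting of \<open>M \<union> L\<close> determine it. Chords of 4-cycles limit the
  splittings, and each remaining one belongs to one of the three families.\<close>

lemma shift_eq_double_star:
  assumes G: "k_tree k G" "k \<ge> 1" and uv: "(u, v) \<in> parcs G"
    and nonempty: "private_nbhd u v G \<noteq> {}" "private_nbhd v u G \<noteq> {}"
    and H: "shift u v G = double_star C p q A {w}" and d: "double_star_data C p q A {w}"
    and A: "A \<noteq> {}" and C: "card C = k - 1" and n: "card (pverts G) = n"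
  shows "q1 G < q1 (graph_G2 k n)"
proof -
  define M where "M = private_nbhd u v G"
  define L where "L = private_nbhd v u G"
  let ?H = "double_star C p q A {w}"
  have ne: "M \<noteq> {}" "L \<noteq> {}" using nonempty by (simp_all add: M_def L_def)
  note e = double_star_def parcs_cone_iff
  have pG: "pair_graph G" and lG: "linked G"
    using k_tree_pair_graph[OF G(1)] k_tree_linked[OF G(2,1)] .
  have nuv: "u \<noteq> v" using pG uv by (auto simp: pair_graph_iff)
  have nH: "card (pverts ?H) = n" using n H by (metis pverts_shift)
  have GM: "G = move M v u ?H" unfolding M_def H[symmetric] by (rule move_shift[OF pG nuv, symmetric])
  have priv: "private_nbhd v u ?H = M \<union> L" "private_nbhd u v ?H = {}" "M \<inter> L = {}"
    
    using private_nbhd_shift[OF pG nuv] unfolding H M_def L_def by (simp_all, auto simp: private_nbhd_def)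
  have uvH: "(u, v) \<in> parcs ?H"
    using uv nuv parcs_shift_iff[OF pG nuv, of u v] H by simp
  \<comment> \<open>An edge from \<open>M\<close> to \<open>L\<close> would close the 4-cycle
    \<open>u\<close>, \<open>x\<close>, \<open>y\<close>, \<open>v\<close> of \<open>G\<close>
    without a chord.\<close>
  have cross: "(x, y) \<notin> parcs ?H" if "x \<in> M" "y \<in> L" for x y
  proof
    assume "(x, y) \<in> parcs ?H"
    moreover have "x \<noteq> u" "x \<noteq> v" "y \<noteq> u" "y \<noteq> v"
      using that pG by (auto simp: M_def L_def private_nbhd_def pair_graph_iff)
    ultimately have "(x, y) \<in> parcs G"
      unfolding H[symmetric] parcs_shift_iff[OF pG nuv] by simp
    moreover have "(u, x) \<in> parcs G" "(y, v) \<in> parcs G" "(v, u) \<in> parcs G" "(u, y) \<notin> parcs G"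
      "(x, v) \<notin> parcs G" "x \<noteq> v" "u \<noteq> y"
      using that uv pG by (auto simp: M_def L_def private_nbhd_def pair_graph_iff)
    ultimately show False using k_tree_chord[OF G(1), of u x y v] by blast
  qed
  \<comment> \<open>Hence a connected piece of \<open>M \<union> L\<close> lies entirely on one
    side.\<close>
  have same: "x \<in> M \<longleftrightarrow> y \<in> M" if "(x, y) \<in> parcs ?H" "x \<in> M \<union> L" "y \<in> M \<union> L" for x y
  proof -
    have "(y, x) \<in> parcs ?H" using that(1) by (auto simp: e)
    then show ?thesis using cross that by blast
  qed
  have ne': "p \<noteq> q" "p \<noteq> w" "q \<noteq> w" "p \<notin> C" "q \<notin> C" "w \<notin> C" "p \<notin> A" "q \<notin> A" "w \<notin> A"
    and dj: "\<And>x. x \<in> C \<Longrightarrow> x \<notin> A"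
    using d by (auto simp: double_star_data_def)
  have adj: "(x, y) \<in> parcs ?H \<longleftrightarrow> x \<noteq> y \<and> x \<in> C \<union> A \<union> {p, q, w} \<and> y \<in> C \<union> A \<union> {p, q, w} \<and>
      (x \<in> C \<or> y \<in> C \<or> x = p \<and> y \<in> insert q A \<or> x = q \<and> y = w \<or> y = p \<and> x \<in> insert q A \<or> y = q \<and> x = w)" for x y
    by (auto simp: e)
  have memP: "u \<in> C \<union> A \<union> {p, q, w}" "v \<in> C \<union> A \<union> {p, q, w}" using uvH unfolding adj by blast+
  \<comment> \<open>Two disjoint nonempty sets cannot have a singleton as union.\<close>
  have nsing: "private_nbhd v u ?H \<noteq> {x}" for x
  proof
    assume "private_nbhd v u ?H = {x}"
    then have eq: "M \<union> L = {x}" using priv(1) by simp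
    obtain m l where "m \<in> M" "l \<in> L" using ne by blast
    moreover from this have "m \<in> {x}" "l \<in> {x}" unfolding eq[symmetric] by simp_all
    ultimately show False using priv(3) by auto
  qed
  have in_v: "x \<in> private_nbhd v u ?H \<longleftrightarrow> (v, x) \<in> parcs ?H \<and> (u, x) \<notin> parcs ?H \<and> x \<noteq> u" for x
    by (simp add: private_nbhd_def)
  have in_u: "(u, x) \<in> parcs ?H \<Longrightarrow> x \<noteq> v \<Longrightarrow> (v, x) \<in> parcs ?H" for x
    using priv(2) by (auto simp: private_nbhd_def)
  have uC: "u \<notin> C"
  proof
    assume "u \<in> C"
    then have "private_nbhd v u ?H = {}" by (auto simp: private_nbhd_def adj)
    then show False using priv(1) ne by auto
  qed
  obtain a0 where a0: "a0 \<in> A" using A by blast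
  \<comment> \<open>If \<open>u = p\<close>, either some neighbour of \<open>p\<close> is not
    adjacent to \<open>v\<close>, or \<open>w\<close> is the only private neighbour of
    \<open>v\<close>.\<close>
  have up: "u \<noteq> p"
  proof
    assume u: "u = p"
    have "v \<in> C"
    proof (rule ccontr)
      assume "v \<notin> C"
      then have "v = q \<or> v \<in> A" using uvH u ne' by (auto simp: adj)
      then show False
        using in_u[of a0] in_u[of q] a0 u ne' dj by (auto simp: adj)
    qed
    then have "private_nbhd v u ?H = {w}"
      using u ne' by (auto simp: private_nbhd_def adj)
    then show False using nsing by blast
  qed
  \<comment> \<open>If \<open>u = w\<close>, the private neighbours of \<open>v\<close> are either
    \<open>p\<close> with its leaves \<open>A\<close>, a connected set that cannot be split, or
    \<open>p\<close> alone.\<close>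
  have uw: "u \<noteq> w"
  proof
    assume u: "u = w"
    show False
    proof (cases "v \<in> C")
      case True
      have "private_nbhd v u ?H = insert p A"
        using u True ne' dj by (auto simp: private_nbhd_def adj)
      moreover have "(p, x) \<in> parcs ?H" if "x \<in> A" for x
        using that ne' by (auto simp: adj)
      ultimately have "x \<in> M \<longleftrightarrow> p \<in> M" if "x \<in> M \<union> L" for x
        using that same[of p x] priv(1) by auto
      then show False using priv(3) ne by blast
    next
      case False
      then have "v = q" using uvH u ne' by (auto simp: adj)
      then have "private_nbhd v u ?H = {p}"
        using u ne' dj by (auto simp: private_nbhd_def adj)
      then show False using nsing by blast
    qed
  qed
  have vw: "v \<noteq> w" and vq: "v \<noteq> q" and vA: "v \<notin> A"
    using uvH uC up uw in_u[of p] memP ne' dj by (auto simp: adj)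
  have "u = q \<Longrightarrow> v \<noteq> p"
    using in_u[of w] ne' by (auto simp: adj)
  \<comment> \<open>These positions lead to the triangle, the triangle pair and the caterpillar, in
    this order.\<close>
  then consider "v \<in> C" "u = q" | "v \<in> C" "u \<in> A" | "v = p" "u \<in> A"
    using memP uC up uw vw vq vA by blast
  then show ?thesis
  proof cases
    case 1
    have "private_nbhd v u ?H = A"
      using 1 ne' dj by (auto simp: private_nbhd_def adj)
    then have Apriv: "A = L \<union> M" using priv(1) by auto
    have CC: "C = insert v (C - {v})" using 1 by auto
    have G': "G = move M v q (double_star (insert v (C - {v})) p q (L \<union> M) {w})"
      using GM 1 CC Apriv by simp
    have disj: "L \<inter> M = {}" using priv(3) by blast
    show ?thesis
      by (rule q1_less_triangle[OF _ _ G(2) _ _ disj ne(2,1) G' pG lG])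
        (use d C nH 1 in \<open>simp_all add: insert_absorb flip: Apriv\<close>)
  next
    case 2
    define A2 where "A2 = M - {q, w}"
    define A1 where "A1 = L - {q, w}"
    have "private_nbhd v u ?H = (A - {u}) \<union> {q, w}"
      using 2 ne' dj by (auto simp: private_nbhd_def adj)
    then have Apriv: "L \<union> M = (A - {u}) \<union> {q, w}" using priv(1) by auto
    have A12: "A = insert u (A1 \<union> A2)" "u \<notin> A1 \<union> A2" "A1 \<inter> A2 = {}"
      using Apriv 2 ne' priv(3) by (auto simp: A1_def A2_def)
    have CC: "C = insert v (C - {v})" "v \<notin> C - {v}" using 2 by auto
    \<comment> \<open>The edge between \<open>q\<close> and \<open>w\<close> keeps them on the same
      side.\<close>
    have qw: "q \<in> M \<longleftrightarrow> w \<in> M" using same[of q w] Apriv ne' by (auto simp: adj)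
    show ?thesis
    proof (cases "q \<in> M")
      case False
      then have M: "M = A2" using qw by (auto simp: A2_def)
      have G': "G = move A2 v u (double_star (insert v (C - {v})) p q (insert u (A1 \<union> A2)) {w})"
        using GM M A12(1) CC(1) by simp
      show ?thesis
        by (rule q1_less_triangle_pair[OF _ CC(2) A12(2) G(2) _ _ A12(3) _ G' G(1)])
          (use d C nH ne M 2 in \<open>simp_all add: insert_absorb flip: A12(1)\<close>)
    next
      case True
      \<comment> \<open>If \<open>q\<close> and \<open>w\<close> go to \<open>u\<close>, exchanging
        \<open>u\<close> with \<open>v\<close> and \<open>A1\<close> with \<open>A2\<close> gives
        the family with \<open>q\<close> and \<open>w\<close> unmoved.\<close>
      then have M: "M = A2 \<union> {q, w}" using qw by (auto simp: A2_def)
      then have L: "L = A1" using priv(3) by (auto simp: A1_def)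
      have uC': "u \<notin> C - {v}" and vA': "v \<notin> A2 \<union> A1" and disj: "A2 \<inter> A1 = {}"
        using uC vA A12 by auto
      have dvu: "double_star_data (insert v (C - {v})) p q (insert u (A1 \<union> A2)) {w}"
        using d unfolding CC(1)[symmetric] A12(1)[symmetric] .
      note d' = double_star_data_swap(1)[OF A12(2) CC(2) dvu]
      have P: "pverts (double_star (insert u (C - {v})) p q (insert v (A2 \<union> A1)) {w}) = pverts ?H"
        using 2 A12(1) by auto
      have "G = move A1 u v (double_star (insert u (C - {v})) p q (insert v (A2 \<union> A1)) {w})"
        using triangle_pair_swap[OF dvu CC(2) A12(2,3)] unfolding GM M CC(1)[symmetric] A12(1)[symmetric] .
      moreover have "card (insert u (C - {v})) = k - 1"
        using 2 C uC d card_Suc_Diff1[of C v] by (simp add: double_star_data_def)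
      moreover have "card (pverts (double_star (insert u (C - {v})) p q (insert v (A2 \<union> A1)) {w})) = n"
        using nH P by simp
      moreover have "A1 \<noteq> {}" using ne(2) L by simp
      ultimately show ?thesis
        using q1_less_triangle_pair[OF d' uC' vA' G(2) _ _ disj _ _ G(1)] by blast
    qed
  next
    case 3
    define A2 where "A2 = M - {q}"
    define A1 where "A1 = L - {q}"
    have "private_nbhd v u ?H = (A - {u}) \<union> {q}"
      using 3 ne' dj by (auto simp: private_nbhd_def adj)
    then have Apriv: "L \<union> M = (A - {u}) \<union> {q}" using priv(1) by auto
    have A12: "A = insert u (A1 \<union> A2)" "u \<notin> A1 \<union> A2" "A1 \<inter> A2 = {}"
      using Apriv 3 ne' priv(3) by (auto simp: A1_def A2_def)
    show ?thesis
    proof (cases "q \<in> M")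
      case False
      then have M: "M = A2" by (auto simp: A2_def)
      have G': "G = move A2 p u (double_star C p q (insert u (A1 \<union> A2)) {w})"
        using GM M A12(1) 3 by simp
      show ?thesis
        by (rule q1_less_caterpillar[OF _ A12(2) G(2) C _ A12(3) _ G' pG lG])
          (use d nH ne M in \<open>simp_all flip: A12(1)\<close>)
    next
      case True
      then have M: "M = insert q A2" by (auto simp: A2_def)
      then have L: "L = A1" using priv(3) by (auto simp: A1_def)
      have pA': "p \<notin> A2 \<union> A1" and disj: "A2 \<inter> A1 = {}"
        using ne' A12 by auto
      have dpu: "double_star_data C p q (insert u (A1 \<union> A2)) {w}"
        using d unfolding A12(1)[symmetric] .
      have d': "double_star_data C u q (insert p (A2 \<union> A1)) {w}"
        using double_star_data_swap(2)[OF A12(2) dpu] .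
      have P: "pverts (double_star C u q (insert p (A2 \<union> A1)) {w}) = pverts ?H"
        using A12(1) by auto
      have "G = move A1 u p (double_star C u q (insert p (A2 \<union> A1)) {w})"
        using caterpillar_swap[OF dpu A12(2,3)] unfolding GM M 3(1) A12(1)[symmetric] .
      moreover have "card (pverts (double_star C u q (insert p (A2 \<union> A1)) {w})) = n"
        using nH P by simp
      moreover have "A1 \<noteq> {}" using ne(2) L by simp
      ultimately show ?thesis
        using q1_less_caterpillar[OF d' pA' G(2) C _ disj _ _ pG lG] by blast
    qed
  qed
qed

section \<open>Climbing through the \<open>k\<close>-trees by shifts\<close>

text \<open>A shift stays among the finitely many \<open>k\<close>-trees on the same vertex set and
  strictly increases \<open>q1\<close>, so the number of \<open>k\<close>-trees with larger
  \<open>q1\<close> drives the induction. The excluded shapes are those of the \<open>k\<close>-star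
  and of \<open>graph_G1\<close>.\<close>

lemma k_tree_iso_G2_or_q1_less:
  fixes G :: "'a pair_pre_digraph"
  assumes k: "k \<ge> 1"
  shows "k_tree k G \<Longrightarrow> card (pverts G) = n \<Longrightarrow>
    \<nexists>K L. finite K \<and> finite L \<and> K \<inter> L = {} \<and> card K = k \<and> G = star_graph K L \<Longrightarrow>
    \<nexists>C p q A w. double_star_data C p q A {w} \<and> card C = k - 1 \<and> A \<noteq> {} \<and> G = double_star C p q A {w} \<Longrightarrow>
    digraph_iso (with_proj G) (with_proj (graph_G2 k n)) \<or> q1 G < q1 (graph_G2 k n)"
proof (induction "card {H. k_tree k H \<and> pverts H = pverts G \<and> q1 H > q1 G}" arbitrary: G rule: less_induct)
  case less
  note kt = less.prems(1) and n = less.prems(2) and nS = less.prems(3) and nD = less.prems(4)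
  have pG: "pair_graph G" and lG: "linked G"
    using k_tree_pair_graph[OF kt] k_tree_linked[OF k kt] .
  obtain u v where uv: "(u, v) \<in> parcs G" "private_nbhd u v G \<noteq> {}" "private_nbhd v u G \<noteq> {}"
    using k_tree_star_or_private_nbhds[OF kt] nS by blast
  then have uvP: "u \<in> pverts G" "v \<in> pverts G" "u \<noteq> v"
    using pG unfolding pair_graph_iff by blast+
  define H where "H = shift u v G"
  have H: "k_tree k H" "pverts H = pverts G" "q1 G < q1 H"
    using k_tree_shift[OF kt uv(1)] shift_increases_q1[OF pG lG uvP uv(2,3)] by (simp_all add: H_def)
  show ?case
  proof (cases "\<exists>K L. finite K \<and> finite L \<and> K \<inter> L = {} \<and> card K = k \<and> H = star_graph K L")
    case True
    then obtain K S where KS: "H = star_graph K S" "finite K" "finite S" "K \<inter> S = {}" "card K = k"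
      by blast
    obtain C p q A B where D: "double_star_data C p q A B" "card C = card K - 1" "A \<noteq> {}" "B \<noteq> {}"
      "G = double_star C p q A B"
      using shift_eq_star_graph[OF pG uv KS(1)[unfolded H_def] KS(2-4)] by metis
    have fin: "finite A" "finite B" using D(1) by (auto simp: double_star_data_def)
    \<comment> \<open>A centre with a single leaf would give \<open>G\<close> the excluded shape,
      whichever centre it is.\<close>
    have "card B \<noteq> 1"
      using nD D KS(5) by (metis card_1_singletonE)
    moreover have "card A \<noteq> 1"
      using nD D KS(5) double_star_data_commute double_star_commute by (metis card_1_singletonE)
    moreover have "card A > 0" "card B > 0" using fin D by (simp_all add: card_gt_0_iff)
    ultimately have "card A \<ge> 2 \<and> card B \<ge> 2" by linarith
    then show ?thesis
      using double_star_iso_or_less[OF D(1) k] D KS(5) n by simp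
  next
    case nSH: False
    show ?thesis
    proof (cases "\<exists>C p q A w. double_star_data C p q A {w} \<and> card C = k - 1 \<and> A \<noteq> {} \<and> H = double_star C p q A {w}")
      case True
      then obtain C p q A w where D: "double_star_data C p q A {w}" "card C = k - 1" "A \<noteq> {}"
        "H = double_star C p q A {w}" by blast
      then show ?thesis
        using shift_eq_double_star[OF kt k uv D(4)[unfolded H_def] D(1,3,2) n] by simp
    next
      case nDH: False
      have finP: "finite (pverts G)" using pG by (simp add: pair_graph_iff)
      have "finite {H :: 'a pair_pre_digraph. k_tree k H \<and> pverts H = pverts G \<and> q1 H > q1 G}"
      proof (rule finite_subset)
        show "{H. k_tree k H \<and> pverts H = pverts G \<and> q1 H > q1 G} \<subseteq>
            (\<lambda>E. \<lparr>pverts = pverts G, parcs = E\<rparr>) ` Pow (pverts G \<times> pverts G)"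
        proof
          fix J assume "J \<in> {H. k_tree k H \<and> pverts H = pverts G \<and> q1 H > q1 G}"
          then have "pverts J = pverts G" "parcs J \<subseteq> pverts G \<times> pverts G"
            using k_tree_pair_graph[of k J] by (auto simp: pair_graph_iff)
          then show "J \<in> (\<lambda>E. \<lparr>pverts = pverts G, parcs = E\<rparr>) ` Pow (pverts G \<times> pverts G)"
            by (intro image_eqI[of _ _ "parcs J"]) auto
        qed
        show "finite ((\<lambda>E. \<lparr>pverts = pverts G, parcs = E\<rparr>) ` Pow (pverts G \<times> pverts G))"
          using finP by simp
      qed
      moreover have "{J. k_tree k J \<and> pverts J = pverts H \<and> q1 J > q1 H}
          \<subset> {J. k_tree k J \<and> pverts J = pverts G \<and> q1 J > q1 G}"
      proof
        show "{J. k_tree k J \<and> pverts J = pverts H \<and> q1 J > q1 H}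
          \<subseteq> {J. k_tree k J \<and> pverts J = pverts G \<and> q1 J > q1 G}"
          using H by (auto simp: H(2))
        have "H \<in> {J. k_tree k J \<and> pverts J = pverts G \<and> q1 J > q1 G}" using H by simp
        moreover have "H \<notin> {J. k_tree k J \<and> pverts J = pverts H \<and> q1 J > q1 H}" by simp
        ultimately show "{J. k_tree k J \<and> pverts J = pverts H \<and> q1 J > q1 H}
          \<noteq> {J. k_tree k J \<and> pverts J = pverts G \<and> q1 J > q1 G}" by blast
      qed
      ultimately have "card {J. k_tree k J \<and> pverts J = pverts H \<and> q1 J > q1 H}
          < card {J. k_tree k J \<and> pverts J = pverts G \<and> q1 J > q1 G}"
        by (rule psubset_card_mono)
      \<comment> \<open>In both alternatives \<open>q1 H\<close> is at most the value of
        \<open>graph_G2\<close>, while \<open>G\<close> lies strictly below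
        \<open>H\<close>.\<close>
      then have "digraph_iso (with_proj H) (with_proj (graph_G2 k n)) \<or> q1 H < q1 (graph_G2 k n)"
        using less.hyps[OF _ H(1) _ nSH nDH] n H(2) by simp
      then have "q1 H \<le> q1 (graph_G2 k n)"
        using digraph_iso_q1[OF k_tree_pair_graph[OF H(1)]] uvP H(2) by force
      then show ?thesis using H(3) by simp
    qed
  qed
qed

theorem theorem2p7:
  fixes k n :: nat and G :: "'a pair_pre_digraph"
  assumes "k \<ge> 1" and "n \<ge> k + 1"
    and "k_tree k G" and "card (pverts G) = n"
    and "\<not> digraph_iso (with_proj G) (with_proj (k_star k (n - k)))"
    and "\<not> digraph_iso (with_proj G) (with_proj (graph_G1 k n))"
  shows "q1 G \<le> q1 (graph_G2 k n) \<and>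
    (q1 G = q1 (graph_G2 k n) \<longleftrightarrow> digraph_iso (with_proj G) (with_proj (graph_G2 k n)))"
proof -
  have pG: "pair_graph G" using k_tree_pair_graph[OF assms(3)] .
  have inj: "inj V" "inj U" by (auto simp: inj_def)
  have ne: "pverts G \<noteq> {}" using assms(2,4) by auto
  have "\<nexists>K L. finite K \<and> finite L \<and> K \<inter> L = {} \<and> card K = k \<and> G = star_graph K L"
  proof
    assume "\<exists>K L. finite K \<and> finite L \<and> K \<inter> L = {} \<and> card K = k \<and> G = star_graph K L"
    then obtain K L where KL: "finite K" "finite L" "K \<inter> L = {}" "card K = k" "G = star_graph K L"
      by blast
    then have "card L = n - k" using assms(4) by (auto simp: card_Un_disjoint)
    then have "\<exists>f. inj_on f (K \<union> L) \<and> k_star k (n - k) = map_graph f (star_graph K L)"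
      unfolding k_star_eq using KL inj by (intro star_graph_iso) (auto simp: card_image inj_on_subset)
    then show False using assms(5) pG by (simp add: digraph_iso_iff KL(5))
  qed
  moreover have "\<nexists>C p q A w. double_star_data C p q A {w} \<and> card C = k - 1 \<and> A \<noteq> {} \<and> G = double_star C p q A {w}"
  proof
    assume "\<exists>C p q A w. double_star_data C p q A {w} \<and> card C = k - 1 \<and> A \<noteq> {} \<and> G = double_star C p q A {w}"
    then obtain C p q A w where D: "double_star_data C p q A {w}" "card C = k - 1" "A \<noteq> {}"
      "G = double_star C p q A {w}" by blast
    \<comment> \<open>The count is \<open>k - 1\<close> vertices in \<open>C\<close>, two centres,
      the leaves in \<open>A\<close> and the leaf \<open>w\<close>.\<close>
    have nk: "n = k + card A + 2" using card_double_star[OF D(1)] D assms(1,4) by simp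
    then have n2: "n \<ge> k + 2" by simp
    have "\<exists>f. inj_on f (pverts (double_star C p q A {w})) \<and> graph_G1 k n = map_graph f (double_star C p q A {w})"
      unfolding graph_G1_eq[OF assms(1) n2]
    proof (rule double_star_iso[OF D(1)])
      show "card C = card (V ` {1..k - 1})" "card A = card (U ` {3..n - k})" "card {w} = card {U 1}"
        using D(2) nk inj by (simp_all add: card_image inj_on_subset)
    qed (auto simp: double_star_data_def)
    then show False using assms(6) pG by (simp add: digraph_iso_iff D(4))
  qed
  ultimately have "digraph_iso (with_proj G) (with_proj (graph_G2 k n)) \<or> q1 G < q1 (graph_G2 k n)"
    using k_tree_iso_G2_or_q1_less[OF assms(1,3,4)] by blast
  \<comment> \<open>Isomorphic graphs share \<open>q1\<close>, so the strict alternative excludes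
    both equality and isomorphism.\<close>
  then show ?thesis
    using digraph_iso_q1[OF pG ne] by fastforce
qed

end
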